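(* Let $r\ge 1$ and, for $l=1,\dots,r$, let $A_l=A_{l1}+A_{l2}\mathbf{j}\in \mathbb{Q}_{\mathbb{R}}^{m\times n_l}$ (with $A_{l1},A_{l2}\in\mathbb{C}^{m\times n_l}$), $B_l\in \mathbb{Q}_{\mathbb{R}}^{s_l\times t}$, and let $E\in \mathbb{Q}_{\mathbb{R}}^{m\times t}$. For each $l$ let $L_l(n_l,s_l)\subseteq \mathbb{Q}_{\mathbb{R}}^{n_l\times s_l}$ be a reduced biquaternion L-structure, with basis matrix $M_{L_l}$. Define $$S_l=\big(h(B_l)^T\otimes A_{l1}+h(B_l\mathbf{j})^T\otimes A_{l2}\big)\mathcal{W}_{n_ls_l}M_{L_l},\qquad Q_1=[\Re(S_1),\dots,\Re(S_r)],\quad Q_2=[\Im(S_1),\dots,\Im(S_r)],$$ $$e=\begin{bmatrix}\mathrm{vec}(\Re(\Psi_E))\\ \mathrm{vec}(\Im(\Psi_E))\end{bmatrix},\qquad \mathcal{T}=\mathrm{diag}(M_{L_1},\dots,M_{L_r})\ \text{(block diagonal)},$$ $$R=(I-Q_1^+Q_1)Q_2^T,\quad Z=\big(I+(I-R^+R)Q_2Q_1^+Q_1^{+T}Q_2^T(I-R^+R)\big)^{-1},$$ $$H=R^++(I-R^+R)ZQ_2Q_1^+Q_1^{+T}(I-Q_2^TR^+).$$ Then the matrix equation $\sum_{l=1}^r A_lX_lB_l=E$ has a solution with $X_l\in L_l(n_l,s_l)$ for $l=1,\dots,r$ if and only if $$\begin{bmatrix}Q_1\\Q_2\end{bmatrix}\begin{bmatrix}Q_1\\Q_2\end{bmatrix}^+e=e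 .$$ In this case, the general solution with $X_l\in L_l(n_l,s_l)$ satisfies $$\begin{bmatrix}\mathrm{vec}(\overrightarrow{X_1})\\ \vdots\\ \mathrm{vec}(\overrightarrow{X_r})\end{bmatrix}=\mathcal{T}\,[Q_1^+-H^TQ_2Q_1^+,\;H^T]\,e+\mathcal{T}\,(I-Q_1^+Q_1-RR^+)\,y,$$ where $y$ is any real vector of suitable size. Further, if the consistency condition holds, then the equation has a unique solution with $X_l\in L_l(n_l,s_l)$, $l=1,\dots,r$, if and only if $$\mathrm{rank}\begin{bmatrix}Q_1\\Q_2\end{bmatrix}=\dim\begin{bmatrix}\mathrm{vec}_{L_1}(\overrightarrow{X_1})\\ \vdots\\ \mathrm{vec}_{L_r}(\overrightarrow{X_r})\end{bmatrix},$$ where the right-hand side is the number of entries of the vector, i.e. the total number of columns of $M_{L_1},\dots,M_{L_r}$. In this case, the unique solution satisfies $$\begin{bmatrix}\mathrm{vec}(\overrightarrow{X_1})\\ \vdots\\ \mathrm{vec}(\overrightarrow{X_r})\end{bmatrix}=\mathcal{T}\,[Q_1^+-H^TQ_2Q_1^+,\;H^T]\,e .$$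
   Context: Reduced biquaternions: $\mathbb{Q}_{\mathbb{R}}$ is the commutative ring of elements $r_0+r_1\mathbf{i}+r_2\mathbf{j}+r_3\mathbf{k}$, $r_i\in\mathbb{R}$, with $\mathbf{i}^2=\mathbf{k}^2=-1$, $\mathbf{j}^2=1$, $\mathbf{i}\mathbf{j}=\mathbf{j}\mathbf{i}=\mathbf{k}$, $\mathbf{j}\mathbf{k}=\mathbf{k}\mathbf{j}=\mathbf{i}$, $\mathbf{k}\mathbf{i}=\mathbf{i}\mathbf{k}=-\mathbf{j}$. Every $Z\in\mathbb{Q}_{\mathbb{R}}^{p\times q}$ is uniquely $Z=Z_1+Z_2\mathbf{j}$ with $Z_1,Z_2\in\mathbb{C}^{p\times q}$ (where $\mathbb{C}=\mathbb{R}+\mathbb{R}\mathbf{i}$). Set $\Psi_Z=[Z_1,Z_2]\in\mathbb{C}^{p\times 2q}$, $h(Z)=\begin{bmatrix}Z_1&Z_2\\Z_2&Z_1\end{bmatrix}$ (so $h(Z\mathbf{j})=\begin{bmatrix}Z_2&Z_1\\Z_1&Z_2\end{bmatrix}$), and $\overrightarrow{Z}=[\Re(Z_1),\Im(Z_1),\Re(Z_2),\Im(Z_2)]\in\mathbb{R}^{p\times 4q}$. $\mathrm{vec}$ stacks the columns of a matrix; $\otimes$ is the Kronecker product; $M^+$ is the Moore–Penrose inverse of a real matrix, $M^{+T}=(M^+)^T$; $\Re,\Im$ are entrywise real and imaginary parts; $I$ denotes identity matrices of suitable size. $$\mathcal{W}_{N}=\begin{bmatrix}I_N&\mathbf{i}I_N&0&0\\0&0&I_N&\mathbf{i}I_N\end{bmatrix}\in\mathbb{C}^{2N\times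 4N}.$$ L-structure: given an $\mathbb{R}$-linear subspace $\Omega\subseteq\mathbb{Q}_{\mathbb{R}}^{pq}$, the associated reduced biquaternion L-structure is $L(p,q)=\{X\in\mathbb{Q}_{\mathbb{R}}^{p\times q}: \mathrm{vec}(X)\in\Omega\}$. Let $\mathcal{G}=\{\mathrm{vec}(\overrightarrow X): X\in L(p,q)\}$, a linear subspace of $\mathbb{R}^{4pq}$. A basis matrix $M_L$ of the structure is a real matrix whose columns form a basis of $\mathcal{G}$; for $X\in L(p,q)$, $\mathrm{vec}_L(\overrightarrow X)$ is the coordinate vector of $\mathrm{vec}(\overrightarrow X)$ in this basis, i.e. $\mathrm{vec}(\overrightarrow X)=M_L\,\mathrm{vec}_L(\overrightarrow X)$. *)

theory Defs
  imports
    Complex_Main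
    "HOL-Library.FuncSet"
    "Jordan_Normal_Form.Matrix"
    "Jordan_Normal_Form.Gauss_Jordan_Elimination"
    "Jordan_Normal_Form.DL_Rank"
begin

datatype rbq = RBQ (rq0: real) (rq1: real) (rq2: real) (rq3: real)

lemma rbq_eq_iff: "x = y \<longleftrightarrow> rq0 x = rq0 y \<and> rq1 x = rq1 y \<and> rq2 x = rq2 y \<and> rq3 x = rq3 y"
  by (auto intro: rbq.expand)

instantiation rbq :: "{comm_ring_1, real_algebra_1}"
begin

definition "0 = RBQ 0 0 0 0"
definition "1 = RBQ 1 0 0 0"
definition "x + y = RBQ (rq0 x + rq0 y) (rq1 x + rq1 y) (rq2 x + rq2 y) (rq3 x + rq3 y)"
definition "- x = RBQ (- rq0 x) (- rq1 x) (- rq2 x) (- rq3 x)"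
definition "x - y = RBQ (rq0 x - rq0 y) (rq1 x - rq1 y) (rq2 x - rq2 y) (rq3 x - rq3 y)"
definition "c *\<^sub>R x = RBQ (c * rq0 x) (c * rq1 x) (c * rq2 x) (c * rq3 x)"

text \<open>The bilinear extension of the multiplication table, which is checked in
  \<open>rbq_units\<close> below.\<close>
definition "x * y = RBQ
  (rq0 x * rq0 y - rq1 x * rq1 y + rq2 x * rq2 y - rq3 x * rq3 y)
  (rq0 x * rq1 y + rq1 x * rq0 y + rq2 x * rq3 y + rq3 x * rq2 y)
  (rq0 x * rq2 y + rq2 x * rq0 y - rq1 x * rq3 y - rq3 x * rq1 y)
  (rq0 x * rq3 y + rq3 x * rq0 y + rq1 x * rq2 y + rq2 x * rq1 y)"

lemmas rbq_defs = zero_rbq_def one_rbq_def plus_rbq_def uminus_rbq_def minus_rbq_def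
  scaleR_rbq_def times_rbq_def

instance
  by standard (simp_all add: rbq_defs rbq_eq_iff algebra_simps)

end

definition rbq_i :: rbq where "rbq_i = RBQ 0 1 0 0"
definition rbq_j :: rbq where "rbq_j = RBQ 0 0 1 0"
definition rbq_k :: rbq where "rbq_k = RBQ 0 0 0 1"

lemma rbq_units:
  "rbq_i * rbq_i = - 1" "rbq_j * rbq_j = 1" "rbq_k * rbq_k = - 1"
  "rbq_i * rbq_j = rbq_k" "rbq_j * rbq_k = rbq_i" "rbq_k * rbq_i = - rbq_j"
  "RBQ a b c d = a *\<^sub>R 1 + b *\<^sub>R rbq_i + c *\<^sub>R rbq_j + d *\<^sub>R rbq_k"
  by (simp_all add: rbq_i_def rbq_j_def rbq_k_def rbq_defs)

text \<open>The complex parts in \<open>z = z\<^sub>1 + z\<^sub>2 j\<close>. Since \<open>i j = k\<close>, the second part is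
  \<open>r\<^sub>2 + r\<^sub>3 i\<close>.\<close>
definition cpart1 :: "rbq \<Rightarrow> complex" where "cpart1 z = Complex (rq0 z) (rq1 z)"
definition cpart2 :: "rbq \<Rightarrow> complex" where "cpart2 z = Complex (rq2 z) (rq3 z)"

definition rbq_of_complex :: "complex \<Rightarrow> rbq" where
  "rbq_of_complex c = RBQ (Re c) (Im c) 0 0"

lemma rbq_complex_parts:
  "z = rbq_of_complex a + rbq_of_complex b * rbq_j \<longleftrightarrow> a = cpart1 z \<and> b = cpart2 z"
  by (auto simp: rbq_eq_iff rbq_of_complex_def rbq_j_def rbq_defs cpart1_def cpart2_def
      complex_eq_iff)


definition join_cols :: "'a :: zero mat \<Rightarrow> 'a mat \<Rightarrow> 'a mat" where
  "join_cols A B = four_block_mat A B (0\<^sub>m 0 (dim_col A)) (0\<^sub>m 0 (dim_col B))"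

text \<open>\<open>block_row nr [A\<^sub>1, \<dots>, A\<^sub>k]\<close> is the matrix \<open>[A\<^sub>1 \<dots> A\<^sub>k]\<close>, where all
  \<open>A\<^sub>i\<close> have \<open>nr\<close> rows.\<close>
definition block_row :: "nat \<Rightarrow> 'a :: zero mat list \<Rightarrow> 'a mat" where
  "block_row nr As = foldr join_cols As (0\<^sub>m nr 0)"

definition stack_vecs :: "'a vec list \<Rightarrow> 'a vec" where
  "stack_vecs vs = foldr (@\<^sub>v) vs vNil"

definition vec_mat :: "'a mat \<Rightarrow> 'a vec" where
  "vec_mat A = stack_vecs (cols A)"

definition kronecker :: "'a :: times mat \<Rightarrow> 'a mat \<Rightarrow> 'a mat" (infixl "\<otimes>\<^sub>K" 70) where
  "A \<otimes>\<^sub>K B = mat (dim_row A * dim_row B) (dim_col A * dim_col B)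
     (\<lambda>(i, j). A $$ (i div dim_row B, j div dim_col B) * B $$ (i mod dim_row B, j mod dim_col B))"


text \<open>The four Penrose equations, which have exactly one solution for every real matrix.\<close>
definition is_pinv :: "real mat \<Rightarrow> real mat \<Rightarrow> bool" where
  "is_pinv A X \<longleftrightarrow> X \<in> carrier_mat (dim_col A) (dim_row A) \<and>
     A * X * A = A \<and> X * A * X = X \<and> (A * X)\<^sup>T = A * X \<and> (X * A)\<^sup>T = X * A"

definition pinv :: "real mat \<Rightarrow> real mat" ("(_\<^sup>\<dagger>)" [1000] 999) where
  "A\<^sup>\<dagger> = (THE X. is_pinv A X)"


definition Psi :: "rbq mat \<Rightarrow> complex mat" where
  "Psi Z = block_row (dim_row Z) [map_mat cpart1 Z, map_mat cpart2 Z]"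

definition hrep :: "rbq mat \<Rightarrow> complex mat" where
  "hrep Z = four_block_mat (map_mat cpart1 Z) (map_mat cpart2 Z) (map_mat cpart2 Z) (map_mat cpart1 Z)"

definition times_j :: "rbq mat \<Rightarrow> rbq mat" where
  "times_j Z = map_mat (\<lambda>z. z * rbq_j) Z"

lemma hrep_times_j:
  "hrep (times_j Z) =
     four_block_mat (map_mat cpart2 Z) (map_mat cpart1 Z) (map_mat cpart1 Z) (map_mat cpart2 Z)"
proof -
  have "cpart1 (z * rbq_j) = cpart2 z" "cpart2 (z * rbq_j) = cpart1 z" for z
    by (simp_all add: cpart1_def cpart2_def rbq_j_def times_rbq_def)
  then have "map_mat cpart1 (times_j Z) = map_mat cpart2 Z"
    "map_mat cpart2 (times_j Z) = map_mat cpart1 Z"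
    by (auto simp: times_j_def)
  then show ?thesis by (simp add: hrep_def)
qed

definition real_rep :: "rbq mat \<Rightarrow> real mat" where
  "real_rep Z = block_row (dim_row Z)
     [map_mat (Re \<circ> cpart1) Z, map_mat (Im \<circ> cpart1) Z,
      map_mat (Re \<circ> cpart2) Z, map_mat (Im \<circ> cpart2) Z]"

definition Wmat :: "nat \<Rightarrow> complex mat" where
  "Wmat N = block_row N [1\<^sub>m N, \<i> \<cdot>\<^sub>m 1\<^sub>m N, 0\<^sub>m N N, 0\<^sub>m N N]
         @\<^sub>r block_row N [0\<^sub>m N N, 0\<^sub>m N N, 1\<^sub>m N, \<i> \<cdot>\<^sub>m 1\<^sub>m N]"


definition real_subspace :: "nat \<Rightarrow> rbq vec set \<Rightarrow> bool" where
  "real_subspace N \<Omega> \<longleftrightarrow> \<Omega> \<subseteq> carrier_vec N \<and> 0\<^sub>v N \<in> \<Omega> \<and>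
     (\<forall>u\<in>\<Omega>. \<forall>v\<in>\<Omega>. u + v \<in> \<Omega>) \<and> (\<forall>c. \<forall>v\<in>\<Omega>. map_vec ((*\<^sub>R) c) v \<in> \<Omega>)"

definition L_struct :: "nat \<Rightarrow> nat \<Rightarrow> rbq vec set \<Rightarrow> rbq mat set" where
  "L_struct p q \<Omega> = {X \<in> carrier_mat p q. vec_mat X \<in> \<Omega>}"

text \<open>\<open>distinct\<close> is needed because \<open>set (cols M)\<close> forgets repeated columns; the number of
  columns of \<open>M\<close> is then the dimension of \<open>G\<close> and \<open>0\<close> columns are allowed when \<open>G\<close> is trivial.\<close>
definition basis_matrix :: "nat \<Rightarrow> real vec set \<Rightarrow> real mat \<Rightarrow> bool" where
  "basis_matrix N G M \<longleftrightarrow> dim_row M = N \<and> distinct (cols M) \<and>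
     vectorspace.basis class_ring ((module_vec TYPE(real) N)\<lparr>carrier := G\<rparr>) (set (cols M))"

text \<open>Matrices have no additive type class, so the sum is taken in the module of
  \<open>m \<times> t\<close> matrices. The extensional product makes \<open>X\<close> undefined outside \<open>{1..r}\<close>, so
  that a unique member is a unique tuple \<open>(X\<^sub>1, \<dots>, X\<^sub>r)\<close>.\<close>
definition L_solutions :: "nat \<Rightarrow> nat \<Rightarrow> nat \<Rightarrow> (nat \<Rightarrow> nat) \<Rightarrow> (nat \<Rightarrow> nat) \<Rightarrow> (nat \<Rightarrow> rbq vec set) \<Rightarrow>
    (nat \<Rightarrow> rbq mat) \<Rightarrow> (nat \<Rightarrow> rbq mat) \<Rightarrow> rbq mat \<Rightarrow> (nat \<Rightarrow> rbq mat) set" where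
  "L_solutions r m t n s \<Omega> A B E = {X \<in> (\<Pi>\<^sub>E l\<in>{1..r}. L_struct (n l) (s l) (\<Omega> l)).
     (\<Oplus>\<^bsub>module_mat TYPE(rbq) m t\<^esub>l\<in>{1..r}. A l * X l * B l) = E}"

definition stacked_rep :: "nat \<Rightarrow> (nat \<Rightarrow> rbq mat) \<Rightarrow> real vec" where
  "stacked_rep r X = stack_vecs (map (\<lambda>l. vec_mat (real_rep (X l))) [1..<Suc r])"

definition L_basis_matrix :: "nat \<Rightarrow> nat \<Rightarrow> rbq vec set \<Rightarrow> real mat \<Rightarrow> bool" where
  "L_basis_matrix p q \<Omega> M \<longleftrightarrow>
     basis_matrix (4 * p * q) ((\<lambda>X. vec_mat (real_rep X)) ` L_struct p q \<Omega>) M"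

end

theory Submission
  imports Defs
begin

text \<open>The equation is \<open>\<real>\<close>-linear in the unknowns, and the L-structures are real vector spaces with
  given bases, so the theorem is a statement about one real linear system in the coordinates.

  Writing matrices as \<open>Z = Z\<^sub>1 + Z\<^sub>2 j\<close>, the map \<open>\<Psi> Z = [Z\<^sub>1, Z\<^sub>2]\<close> satisfies
  \<open>\<Psi> (A X B) = A\<^sub>1 (\<Psi> X) h(B) + A\<^sub>2 (\<Psi> X) h(B j)\<close> (lemma \<open>Psi_mult\<close>). Together with
  \<open>vec (P Y Q) = (Q\<^sup>T \<otimes> P) vec Y\<close> and \<open>vec (\<Psi> X) = W M y\<close> for the coordinate vector \<open>y\<close> of \<open>X\<close>,
  this expresses \<open>vec (\<Psi> (A\<^sub>l X\<^sub>l B\<^sub>l))\<close> as \<open>S\<^sub>l y\<^sub>l\<close>. Separating real and imaginary parts, the tuples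
  that solve the equation correspond to the real solutions of \<open>V y = e\<close> with \<open>V = [Q1; Q2]\<close>
  (lemma \<open>L_solutions_bij_betw\<close>).

  A system \<open>V y = e\<close> is solvable iff \<open>V V\<^sup>\<dagger> e = e\<close>, its solutions are then
  \<open>V\<^sup>\<dagger> e + (I - V\<^sup>\<dagger> V) z\<close>, and there is exactly one iff \<open>V\<close> has full column rank. The explicit
  matrices of the theorem are the blocks of \<open>V\<^sup>\<dagger>\<close> by Cline's formula for partitioned matrices
  (lemma \<open>is_pinv_append_rows\<close>), which also yields \<open>V\<^sup>\<dagger> V = Q1\<^sup>\<dagger> Q1 + R R\<^sup>\<dagger>\<close>. The formula is
  verified by checking the four Penrose equations, and the same verification, applied row by row,
  proves that every real matrix has a Moore-Penrose inverse.\<close>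

section \<open>Matrix algebra with dimensions as side conditions\<close>

text \<open>Matrices of different shapes form no ring, so the ring laws are restated with
  equations between dimensions as side conditions. The simplifier discharges these by itself, which
  makes the laws usable as a normalization procedure: products are associated to the
  right and distributed over sums and differences, transposes are moved to the factors.\<close>

lemma mult_assoc_dims:
  fixes A B C :: "'a :: semiring_0 mat"
  assumes "dim_col A = dim_row B" "dim_col B = dim_row C"
  shows "A * B * C = A * (B * C)"
  using assms by (intro assoc_mult_mat[of A "dim_row A" "dim_col A" B "dim_col B" C "dim_col C"]) auto

text \<open>With right-associated products, a rule \<open>A * B = C\<close> no longer matches inside a longer
  product; this is its version with a tail.\<close>
lemma mult_extend:
  fixes A B C :: "'a :: semiring_0 mat"
  assumes "A * B = C" "dim_col A = dim_row B" "dim_col B = dim_row Y"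
  shows "A * (B * Y) = C * Y"
  using assms by (auto simp flip: mult_assoc_dims)

lemma mult_minus_dims:
  fixes A B C :: "'a :: ring mat"
  assumes "dim_col A = dim_row B" "dim_row B = dim_row C" "dim_col B = dim_col C"
  shows "A * (B - C) = A * B - A * C"
  using assms by (intro mult_minus_distrib_mat[of A "dim_row A" "dim_col A" B "dim_col B" C]) auto

lemma minus_mult_dims:
  fixes A B C :: "'a :: ring mat"
  assumes "dim_col B = dim_row A" "dim_row B = dim_row C" "dim_col B = dim_col C"
  shows "(B - C) * A = B * A - C * A"
  using assms by (intro minus_mult_distrib_mat[of B "dim_row B" "dim_col B" C A "dim_col A"]) auto

lemma mult_add_dims:
  fixes A B C :: "'a :: ring mat"
  assumes "dim_col A = dim_row B" "dim_row B = dim_row C" "dim_col B = dim_col C"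
  shows "A * (B + C) = A * B + A * C"
  using assms by (intro mult_add_distrib_mat[of A "dim_row A" "dim_col A" B "dim_col B" C]) auto

lemma add_mult_dims:
  fixes A B C :: "'a :: ring mat"
  assumes "dim_col B = dim_row A" "dim_row B = dim_row C" "dim_col B = dim_col C"
  shows "(B + C) * A = B * A + C * A"
  using assms by (intro add_mult_distrib_mat[of B "dim_row B" "dim_col B" C A "dim_col A"]) auto

lemma transpose_mult_dims:
  fixes A B :: "'a :: comm_semiring_0 mat"
  assumes "dim_col A = dim_row B"
  shows "(A * B)\<^sup>T = B\<^sup>T * A\<^sup>T"
  using assms by (intro transpose_mult[of A "dim_row A" "dim_col A" B "dim_col B"]) auto

lemma transpose_minus_dims:
  fixes A B :: "'a :: ring mat"
  assumes "dim_row A = dim_row B" "dim_col A = dim_col B"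
  shows "(A - B)\<^sup>T = A\<^sup>T - B\<^sup>T"
  using assms by (intro eq_matI) auto

lemma transpose_add_dims:
  fixes A B :: "'a :: ring mat"
  assumes "dim_row A = dim_row B" "dim_col A = dim_col B"
  shows "(A + B)\<^sup>T = A\<^sup>T + B\<^sup>T"
  using assms by (intro eq_matI) auto

lemma one_mult_dims: "dim_row A = n \<Longrightarrow> 1\<^sub>m n * A = (A :: 'a :: semiring_1 mat)"
  by (rule left_mult_one_mat')

lemma mult_one_dims: "dim_col A = n \<Longrightarrow> A * 1\<^sub>m n = (A :: 'a :: semiring_1 mat)"
  by (rule right_mult_one_mat')

lemma zero_mult_dims: "dim_row A = n \<Longrightarrow> 0\<^sub>m k n * A = (0\<^sub>m k (dim_col A) :: 'a :: semiring_0 mat)"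
  by (intro eq_matI) auto

lemma mult_zero_dims: "dim_col A = n \<Longrightarrow> A * 0\<^sub>m n k = (0\<^sub>m (dim_row A) k :: 'a :: semiring_0 mat)"
  by (intro eq_matI) auto

lemma minus_self_dims [simp]: "A - A = (0\<^sub>m (dim_row A) (dim_col A) :: 'a :: ring mat)"
  by (intro eq_matI) auto

lemma minus_zero_dims [simp]:
  "dim_row A = k \<Longrightarrow> dim_col A = n \<Longrightarrow> A - 0\<^sub>m k n = (A :: 'a :: ring mat)"
  "dim_row A = k \<Longrightarrow> dim_col A = n \<Longrightarrow> A + 0\<^sub>m k n = (A :: 'a :: ring mat)"
  "dim_row A = k \<Longrightarrow> dim_col A = n \<Longrightarrow> 0\<^sub>m k n + A = (A :: 'a :: ring mat)"
  by (auto intro!: eq_matI)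

lemmas mat_dims_simps = mult_assoc_dims mult_minus_dims minus_mult_dims mult_add_dims add_mult_dims
  transpose_mult_dims transpose_minus_dims transpose_add_dims one_mult_dims mult_one_dims
  zero_mult_dims mult_zero_dims

section \<open>Matrices composed of two blocks\<close>

lemma join_cols_dim [simp]:
  "dim_row (join_cols A B) = dim_row A" "dim_col (join_cols A B) = dim_col A + dim_col B"
  by (simp_all add: join_cols_def)

lemma append_rows_dim [simp]:
  "dim_row (A @\<^sub>r B) = dim_row A + dim_row B" "dim_col (A @\<^sub>r B) = dim_col A"
  by (simp_all add: append_rows_def)

lemma join_cols_index:
  "i < dim_row A \<Longrightarrow> j < dim_col A + dim_col B \<Longrightarrow>
    join_cols A B $$ (i, j) = (if j < dim_col A then A $$ (i, j) else B $$ (i, j - dim_col A))"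
  by (simp add: join_cols_def)

lemma append_rows_index:
  "i < dim_row A + dim_row B \<Longrightarrow> j < dim_col A \<Longrightarrow>
    (A @\<^sub>r B) $$ (i, j) = (if i < dim_row A then A $$ (i, j) else B $$ (i - dim_row A, j))"
  by (simp add: append_rows_def)

lemma join_cols_mult_append_rows:
  fixes A B C D :: "'a :: semiring_0 mat"
  assumes "A \<in> carrier_mat n a" "B \<in> carrier_mat n b" "C \<in> carrier_mat a m" "D \<in> carrier_mat b m"
  shows "join_cols A B * (C @\<^sub>r D) = A * C + B * D"
proof -
  have "join_cols A B * (C @\<^sub>r D) =
    four_block_mat (A * C + B * D) (A * 0\<^sub>m a 0 + B * 0\<^sub>m b 0) (0\<^sub>m 0 a * C + 0\<^sub>m 0 b * D) (0\<^sub>m 0 a * 0\<^sub>m a 0 + 0\<^sub>m 0 b * 0\<^sub>m b 0)"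
    unfolding join_cols_def append_rows_def using assms
    by (subst mult_four_block_mat[of _ n a _ b _ 0 _ _ m _ 0]) auto
  also have "\<dots> = A * C + B * D"
    using assms by (intro eq_matI) auto
  finally show ?thesis .
qed

lemma append_rows_mult_join_cols:
  fixes A B C D :: "'a :: semiring_0 mat"
  assumes "A \<in> carrier_mat a n" "B \<in> carrier_mat b n" "C \<in> carrier_mat n c" "D \<in> carrier_mat n d"
  shows "(A @\<^sub>r B) * join_cols C D = four_block_mat (A * C) (A * D) (B * C) (B * D)"
  unfolding join_cols_def append_rows_def using assms
  by (subst mult_four_block_mat[of _ a n _ 0 _ b _ _ c _ d]) (auto intro!: cong_four_block_mat right_add_zero_mat)

lemma mult_join_cols:
  fixes A B C :: "'a :: semiring_0 mat"
  assumes "A \<in> carrier_mat n k" "B \<in> carrier_mat k b" "C \<in> carrier_mat k c"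
  shows "A * join_cols B C = join_cols (A * B) (A * C)"
  using assms by (intro eq_matI) (auto simp: join_cols_index scalar_prod_def intro!: sum.cong)

lemma append_rows_mult:
  fixes A B C :: "'a :: semiring_0 mat"
  assumes "A \<in> carrier_mat a k" "B \<in> carrier_mat b k" "C \<in> carrier_mat k c"
  shows "(A @\<^sub>r B) * C = (A * C) @\<^sub>r (B * C)"
  using assms by (intro eq_matI) (auto simp: append_rows_index scalar_prod_def intro!: sum.cong)

section \<open>The Moore-Penrose inverse of a matrix split into two blocks of rows\<close>

lemma is_pinvD:
  assumes "is_pinv A X"
  shows "X \<in> carrier_mat (dim_col A) (dim_row A)" "A * X * A = A" "X * A * X = X"
    "(A * X)\<^sup>T = A * X" "(X * A)\<^sup>T = X * A"
  by (rule conjE[OF assms[unfolded is_pinv_def]], elim conjE, assumption)+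

text \<open>Both \<open>A X\<close> and \<open>A Y\<close> are the orthogonal projection onto the column space of \<open>A\<close>, and both
  \<open>X A\<close> and \<open>Y A\<close> the one onto its row space; an inverse is determined by these two projections.\<close>
lemma is_pinv_unique:
  assumes "is_pinv A X" "is_pinv A Y"
  shows "X = Y"
proof -
  note X = assms(1)[unfolded is_pinv_def] and Y = assms(2)[unfolded is_pinv_def]
  have [simp]: "dim_row X = dim_col A" "dim_col X = dim_row A" "dim_row Y = dim_col A" "dim_col Y = dim_row A"
    using X Y by auto
  have AX: "A * X = A * Y"
  proof -
    have "A * X = (A * Y * A) * X" using Y by simp
    also have "\<dots> = (A * Y) * (A * X)" by (simp add: mult_assoc_dims)
    also have "\<dots> = (A * Y)\<^sup>T * (A * X)\<^sup>T" using X Y by simp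
    also have "\<dots> = (A * X * (A * Y))\<^sup>T" by (rule transpose_mult_dims[symmetric]) simp
    also have "A * X * (A * Y) = A * X * A * Y" by (simp add: mult_assoc_dims)
    also have "\<dots> = A * Y" using X by simp
    finally show ?thesis using Y by simp
  qed
  have XA: "X * A = Y * A"
  proof -
    have "X * A = X * (A * Y * A)" using Y by simp
    also have "\<dots> = (X * A) * (Y * A)" by (simp add: mult_assoc_dims)
    also have "\<dots> = (X * A)\<^sup>T * (Y * A)\<^sup>T" using X Y by simp
    also have "\<dots> = (Y * A * (X * A))\<^sup>T" by (rule transpose_mult_dims[symmetric]) simp
    also have "Y * A * (X * A) = Y * (A * X * A)" by (simp add: mult_assoc_dims)
    also have "\<dots> = Y * A" using X by simp
    finally show ?thesis using Y by simp
  qed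
  have "X = X * A * X" using X by simp
  also have "\<dots> = Y * A * X" by (simp add: XA)
  also have "\<dots> = Y * (A * Y)" by (simp add: mult_assoc_dims AX)
  also have "\<dots> = Y" using Y by (simp add: mult_assoc_dims)
  finally show ?thesis .
qed

text \<open>This is Cline's formula for a partitioned matrix, transposed. Write \<open>N = P Q1\<close> for the
  orthogonal projection onto the row space of \<open>Q1\<close>, \<open>R\<close> for the transpose of the part of \<open>Q2\<close> that is
  orthogonal to that space, \<open>F = I - S R\<close> and \<open>L = Q2 P\<close>. Since \<open>N R = 0\<close>, the projection onto the row
  space of the whole matrix \<open>V\<close> is \<open>N + R S\<close>, and this is what \<open>X V\<close> turns out to be for the
  claimed inverse \<open>X\<close>. Hence \<open>X V\<close> is symmetric and \<open>V X V = V\<close>, \<open>X V X = X\<close> follow block by block.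
  The symmetry of \<open>V X\<close> is what forces the correction term with \<open>Z\<close>: because \<open>F\<close> and \<open>Z\<close> are
  symmetric and commute, \<open>F Z\<close> is symmetric, and the blocks of \<open>V X\<close> become \<open>Q1 P - L\<^sup>T F Z L\<close>, \<open>L\<^sup>T F Z\<close>, \<open>F Z L\<close>
  and \<open>I - F Z\<close>.\<close>
lemma is_pinv_append_rows:
  fixes Q1 Q2 P S Z :: "real mat" and k l d :: nat
  defines "R \<equiv> (1\<^sub>m d - P * Q1) * Q2\<^sup>T"
  defines "H \<equiv> S + (1\<^sub>m l - S * R) * Z * Q2 * P * P\<^sup>T * (1\<^sub>m d - Q2\<^sup>T * S)"
  assumes Q1: "Q1 \<in> carrier_mat k d" and Q2: "Q2 \<in> carrier_mat l d"
    and P: "is_pinv Q1 P" and S: "is_pinv R S" and Z: "Z \<in> carrier_mat l l"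
    and ZG: "Z * (1\<^sub>m l + (1\<^sub>m l - S * R) * Q2 * P * P\<^sup>T * Q2\<^sup>T * (1\<^sub>m l - S * R)) = 1\<^sub>m l"
    and GZ: "(1\<^sub>m l + (1\<^sub>m l - S * R) * Q2 * P * P\<^sup>T * Q2\<^sup>T * (1\<^sub>m l - S * R)) * Z = 1\<^sub>m l"
  shows "is_pinv (Q1 @\<^sub>r Q2) (join_cols (P - H\<^sup>T * Q2 * P) (H\<^sup>T))"
    and "join_cols (P - H\<^sup>T * Q2 * P) (H\<^sup>T) * (Q1 @\<^sub>r Q2) = P * Q1 + R * S"
proof -
  have R: "R \<in> carrier_mat d l" using Q1 Q2 P by (auto simp: R_def is_pinv_def)
  have Pc: "P \<in> carrier_mat d k" and Sc: "S \<in> carrier_mat l d"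
    using P S Q1 R by (auto simp: is_pinv_def)
  have Hc: "H \<in> carrier_mat l d" using Pc Sc Q2 R Z by (auto simp: H_def)
  have dims [simp]: "dim_row Q1 = k" "dim_col Q1 = d" "dim_row Q2 = l" "dim_col Q2 = d"
    "dim_row P = d" "dim_col P = k" "dim_row S = l" "dim_col S = d" "dim_row R = d" "dim_col R = l"
    "dim_row Z = l" "dim_col Z = l" "dim_row H = l" "dim_col H = d"
    using Q1 Q2 Pc Sc R Z Hc by auto
  note ac = mult_assoc_dims
  note Pp = P[unfolded is_pinv_def] and Sp = S[unfolded is_pinv_def]
  define N where "N = P * Q1"
  define F where "F = 1\<^sub>m l - S * R"
  define L where "L = Q2 * P"
  have Nd [simp]: "dim_row N = d" "dim_col N = d" and Fd [simp]: "dim_row F = l" "dim_col F = l"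
    and Ld [simp]: "dim_row L = l" "dim_col L = k"
    by (simp_all add: N_def F_def L_def)
  have NT: "N\<^sup>T = N" using Pp by (simp add: N_def)
  have NP: "N * P = P" and Q1N: "Q1 * N = Q1" using Pp by (simp_all add: N_def ac)
  have NN: "N * N = N" by (metis NP N_def ac dims(1) dims(5) dims(6) Nd(2))
  have RST: "(R * S)\<^sup>T = R * S" and SRT: "(S * R)\<^sup>T = S * R" using Sp by auto
  have RSR: "R * (S * R) = R" and SRS: "S * (R * S) = S" using Sp by (simp_all add: ac)
  have FT: "F\<^sup>T = F" by (simp add: F_def transpose_minus_dims SRT)
  have R_eq: "R = Q2\<^sup>T - N * Q2\<^sup>T" by (simp add: R_def N_def mat_dims_simps)
  have RT_eq: "R\<^sup>T = Q2 - Q2 * N" by (simp add: R_eq mat_dims_simps NT)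
  have NR: "N * R = 0\<^sub>m d l" unfolding R_eq by (simp add: mat_dims_simps NN flip: ac)
  have Q1R: "Q1 * R = 0\<^sub>m k l" unfolding R_eq by (simp add: mat_dims_simps Q1N flip: ac)
  have RTP: "R\<^sup>T * P = 0\<^sub>m l k" unfolding RT_eq by (simp add: minus_mult_dims ac NP)
  have S_left: "S = S * S\<^sup>T * R\<^sup>T"
    by (metis RST SRS ac dims(7-10) index_transpose_mat(2,3) transpose_mult_dims)
  \<comment> \<open>Through \<open>S = S S\<^sup>T R\<^sup>T\<close>, whatever \<open>R\<^sup>T\<close> annihilates is annihilated by \<open>S\<close> as well.\<close>
  have SP: "S * P = 0\<^sub>m l k" by (subst S_left) (simp add: ac RTP mult_zero_dims)
  have SN: "S * N = 0\<^sub>m l d" by (simp add: N_def SP zero_mult_dims flip: ac)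
  have SQ1: "S * Q1\<^sup>T = 0\<^sub>m l k"
  proof -
    have "R\<^sup>T * Q1\<^sup>T = 0\<^sub>m l k" by (metis Q1R dims(2,9) transpose_mult_dims zero_transpose_mat)
    then show ?thesis by (subst S_left) (simp add: ac mult_zero_dims)
  qed
  have PR: "P\<^sup>T * R = 0\<^sub>m k l"
    by (metis RTP dims(5,9) index_transpose_mat(3) transpose_mult_dims transpose_transpose zero_transpose_mat)
  have PN: "P\<^sup>T * N = P\<^sup>T"
    by (metis NP NT Nd(2) dims(5) transpose_mult_dims)
  have SQ2: "S * Q2\<^sup>T = S * R"
    by (simp add: R_eq mult_minus_dims SN zero_mult_dims flip: ac)
  have H_eq: "H = S + F * Z * L * (P\<^sup>T - P\<^sup>T * Q2\<^sup>T * S)"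
    by (simp add: H_def F_def L_def mat_dims_simps)
  have LPT: "L * (P\<^sup>T * Q1\<^sup>T) = L"
  proof -
    have "P\<^sup>T * Q1\<^sup>T = Q1 * P" using Pp by (simp add: transpose_mult_dims)
    then show ?thesis using Pp by (simp add: L_def ac)
  qed
  have LTE: "L\<^sup>T = P\<^sup>T * Q2\<^sup>T" by (simp add: L_def transpose_mult_dims)
  define G where "G = F * (L * (L\<^sup>T * F))"
  have G1: "1\<^sub>m l + (1\<^sub>m l - S * R) * Q2 * P * P\<^sup>T * Q2\<^sup>T * (1\<^sub>m l - S * R) = 1\<^sub>m l + G"
    by (simp add: G_def F_def[symmetric] L_def transpose_mult_dims ac)
  have Gd [simp]: "dim_row G = l" "dim_col G = l" by (simp_all add: G_def)
  have ZG': "Z + Z * G = 1\<^sub>m l" using ZG by (simp add: G1 mult_add_dims mult_one_dims)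
  have GZ': "Z + G * Z = 1\<^sub>m l" using GZ by (simp add: G1 add_mult_dims one_mult_dims)
  have FF: "F * F = F"
    by (simp add: F_def mat_dims_simps RSR)
  have FF': "F * (F * Y) = F * Y" if "dim_row Y = l" for Y
    using FF that by (metis Fd ac)
  have FG: "F * G = G" by (simp add: G_def FF')
  have GF: "G * F = G" by (simp add: G_def ac FF)
  \<comment> \<open>\<open>Z\<close> is the inverse of \<open>I + G\<close>, so it commutes with everything that commutes with \<open>G\<close>.\<close>
  have FZ: "F * Z = Z * F"
  proof -
    have "F * Z = (Z + Z * G) * (F * Z)" by (simp add: ZG' one_mult_dims)
    also have "\<dots> = Z * (F * Z) + Z * (G * Z)" by (simp add: add_mult_dims ac mult_extend[OF GF])
    also have "\<dots> = Z * (F * (Z + G * Z))" by (simp add: mult_add_dims mult_extend[OF FG])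
    also have "\<dots> = Z * F" by (simp add: GZ' mult_one_dims)
    finally show ?thesis .
  qed
  have ZT: "Z\<^sup>T = Z"
  proof -
    have GT: "G\<^sup>T = G" by (simp add: G_def transpose_mult_dims FT ac)
    have e: "Z\<^sup>T + G * Z\<^sup>T = 1\<^sub>m l" using arg_cong[OF ZG', of transpose_mat]
      by (simp add: transpose_add_dims transpose_mult_dims GT)
    have "Z = Z * (Z\<^sup>T + G * Z\<^sup>T)" by (simp add: e mult_one_dims)
    also have "\<dots> = (Z + Z * G) * Z\<^sup>T" by (simp add: mult_add_dims add_mult_dims ac)
    also have "\<dots> = Z\<^sup>T" by (simp add: ZG' one_mult_dims)
    finally show ?thesis by simp
  qed
  have FZT: "(F * Z)\<^sup>T = F * Z" by (simp add: transpose_mult_dims ZT FT FZ)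
  have HQ1: "H * Q1\<^sup>T = F * Z * L"
    by (simp add: H_eq mat_dims_simps SQ1 LPT)
  have HQ2: "H * Q2\<^sup>T = 1\<^sub>m l - F * Z"
  proof -
    have "H * Q2\<^sup>T = S * R + F * (Z * (L * (L\<^sup>T - L\<^sup>T * (S * R))))"
      by (simp add: H_eq mat_dims_simps SQ2 LTE)
    also have "L\<^sup>T - L\<^sup>T * (S * R) = L\<^sup>T * F" by (simp add: F_def mat_dims_simps)
    also have "F * (Z * (L * (L\<^sup>T * F))) = Z * G"
      by (simp add: G_def FZ flip: ac)
    finally have e: "H * Q2\<^sup>T = S * R + Z * G" .
    have "F * Z = F * (Z + Z * G) - F * (Z * G)"
      by (intro eq_matI) (auto simp: mult_add_dims simp del: index_mult_mat(1))
    also have "F * (Z * G) = Z * G" using FZ FG by (metis Fd Gd ac dims(11,12))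
    finally have "F * Z = F - Z * G" by (simp add: ZG' mult_one_dims)
    with e show ?thesis
      by (intro eq_matI) (auto simp: F_def simp del: index_mult_mat(1))
  qed
  define X1 where "X1 = P - H\<^sup>T * Q2 * P"
  have X1d [simp]: "dim_row X1 = d" "dim_col X1 = k" by (simp_all add: X1_def)
  have RH: "R * H = R * S"
  proof -
    have RF: "R * F = 0\<^sub>m d l" by (simp add: F_def mat_dims_simps RSR)
    then have "R * (F * Y) = 0\<^sub>m d (dim_col Y)" if "dim_row Y = l" for Y
      using that by (simp add: zero_mult_dims flip: ac)
    then show ?thesis by (simp add: H_eq mat_dims_simps)
  qed
  have XV: "X1 * Q1 + H\<^sup>T * Q2 = N + R * S"
  proof -
    have "X1 * Q1 + H\<^sup>T * Q2 = N - H\<^sup>T * (Q2 * N) + H\<^sup>T * Q2"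
      by (simp add: X1_def mat_dims_simps N_def)
    also have "\<dots> = N + H\<^sup>T * R\<^sup>T"
      by (simp add: RT_eq mult_minus_dims) (intro eq_matI, auto simp del: index_mult_mat(1))
    also have "H\<^sup>T * R\<^sup>T = (R * H)\<^sup>T" by (simp add: transpose_mult_dims)
    finally show ?thesis by (simp add: RH RST)
  qed
  have XVT: "(N + R * S)\<^sup>T = N + R * S"
    by (simp add: transpose_add_dims NT RST)
  have Q1X: "Q1 * (N + R * S) = Q1"
    by (simp add: mat_dims_simps Q1N) (simp add: mult_extend[OF Q1R] zero_mult_dims)
  have Q2X: "Q2 * (N + R * S) = Q2"
  proof -
    have "(R * S * R)\<^sup>T = R\<^sup>T * (R * S)\<^sup>T" by (rule transpose_mult_dims) simp
    then have "R\<^sup>T * (R * S) = R\<^sup>T" using Sp by simp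
    then have e: "Q2 * (R * S) = R\<^sup>T"
      by (simp add: RT_eq mat_dims_simps mult_extend[OF NR])
    show ?thesis
      by (simp add: mult_add_dims e) (simp add: RT_eq, intro eq_matI, auto simp del: index_mult_mat(1))
  qed
  have HX: "H * (N + R * S) = H"
  proof -
    have 1: "H * N = F * Z * L * P\<^sup>T"
      by (simp add: H_eq mat_dims_simps SN PN)
    have 2: "H * (R * S) = S - F * Z * L * (P\<^sup>T * Q2\<^sup>T * S)"
      by (simp add: H_eq mat_dims_simps SRS) (simp add: mult_extend[OF PR] mat_dims_simps, intro eq_matI, auto simp del: index_mult_mat(1))
    have "H * (N + R * S) = F * Z * L * P\<^sup>T + (S - F * Z * L * (P\<^sup>T * Q2\<^sup>T * S))"
      by (simp only: mult_add_dims 1 2 dims Nd index_mult_mat)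
    also have "\<dots> = H"
      by (simp add: H_eq mult_minus_dims ac) (intro eq_matI, auto simp del: index_mult_mat(1))
    finally show ?thesis .
  qed
  have XHT: "(N + R * S) * H\<^sup>T = H\<^sup>T"
    using arg_cong[OF HX, of transpose_mat] by (simp add: transpose_mult_dims[of H] XVT)
  have XP: "(N + R * S) * P = P"
    by (simp add: mat_dims_simps NP SP)
  have XX1: "(N + R * S) * X1 = X1"
    unfolding X1_def by (simp add: mult_minus_dims XP) (simp add: XHT flip: ac)
  have Q2HT: "Q2 * H\<^sup>T = 1\<^sub>m l - F * Z"
    using arg_cong[OF HQ2, of transpose_mat] by (simp add: transpose_mult_dims[of H] transpose_minus_dims FZT)
  have Q1HT: "Q1 * H\<^sup>T = L\<^sup>T * (F * Z)"
    using arg_cong[OF HQ1, of transpose_mat] by (simp add: transpose_mult_dims[of H] transpose_mult_dims[of _ L] FZT)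
  have Q2X1: "Q2 * X1 = F * Z * L"
    unfolding X1_def by (simp add: mult_minus_dims ac L_def[symmetric])
      (simp add: mult_extend[OF Q2HT] mat_dims_simps, intro eq_matI, auto simp del: index_mult_mat(1))
  have Q1X1: "Q1 * X1 = Q1 * P - L\<^sup>T * (F * Z * L)"
    unfolding X1_def by (simp add: mult_minus_dims ac L_def[symmetric])
      (simp add: mult_extend[OF Q1HT] ac)
  have Q1X1T: "(Q1 * X1)\<^sup>T = Q1 * X1"
  proof -
    have "(F * Z * L)\<^sup>T = L\<^sup>T * (F * Z)" by (simp add: transpose_mult_dims[of _ L] FZT)
    then have "(L\<^sup>T * (F * Z * L))\<^sup>T = L\<^sup>T * (F * Z * L)"
      by (simp add: transpose_mult_dims[of "L\<^sup>T"]) (simp add: ac)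
    then show ?thesis using Pp by (simp add: Q1X1 transpose_minus_dims)
  qed
  let ?V = "Q1 @\<^sub>r Q2" and ?X = "join_cols X1 (H\<^sup>T)"
  have c: "Q1 \<in> carrier_mat k d" "Q2 \<in> carrier_mat l d" "X1 \<in> carrier_mat d k" "H\<^sup>T \<in> carrier_mat d l"
    "N + R * S \<in> carrier_mat d d" by (rule carrier_matI; simp)+
  have VX: "?X * ?V = N + R * S"
    using join_cols_mult_append_rows[OF c(3,4,1,2)] XV by simp
  have VXT: "?V * ?X = four_block_mat (Q1 * X1) (L\<^sup>T * (F * Z)) (F * Z * L) (1\<^sub>m l - F * Z)"
    using append_rows_mult_join_cols[OF c(1,2,3,4)] by (simp add: Q1HT Q2HT Q2X1)
  have "?V * ?X * ?V = ?V * (N + R * S)" by (subst mult_assoc_dims) (simp_all add: VX)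
  also have "\<dots> = ?V" by (simp add: append_rows_mult[OF c(1,2,5)] Q1X Q2X)
  finally have 1: "?V * ?X * ?V = ?V" .
  have 2: "?X * ?V * ?X = ?X"
    unfolding VX by (simp add: mult_join_cols[OF c(5,3,4)] XX1 XHT)
  have "(?V * ?X)\<^sup>T = ?V * ?X"
    unfolding VXT
    by (subst transpose_four_block_mat[of _ k k _ l _ l])
      (auto simp: Q1X1T transpose_minus_dims FZT transpose_mult_dims[of _ L] transpose_mult_dims[of "L\<^sup>T"])
  moreover have "?X \<in> carrier_mat (dim_col ?V) (dim_row ?V)" by (rule carrier_matI; simp)
  ultimately show "is_pinv (Q1 @\<^sub>r Q2) (join_cols (P - H\<^sup>T * Q2 * P) (H\<^sup>T))"
    using 1 2 XVT unfolding is_pinv_def X1_def[symmetric] by (simp only: VX simp_thms)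
  show "join_cols (P - H\<^sup>T * Q2 * P) (H\<^sup>T) * (Q1 @\<^sub>r Q2) = P * Q1 + R * S"
    using VX by (simp add: X1_def N_def)
qed

section \<open>Existence of the Moore-Penrose inverse\<close>

lemma scalar_prod_self_ge_0: "(v :: real vec) \<bullet> v \<ge> 0"
  by (simp add: scalar_prod_def sum_nonneg)

lemma scalar_prod_self_eq_0:
  assumes "(v :: real vec) \<bullet> v = 0" "v \<in> carrier_vec n"
  shows "v = 0\<^sub>v n"
  using assms by (intro eq_vecI) (auto simp: scalar_prod_def sum_nonneg_eq_0_iff)

text \<open>A Gram matrix is positive semidefinite: if \<open>(I + W W\<^sup>T) v = 0\<close>, then
  \<open>v \<bullet> v + W\<^sup>T v \<bullet> W\<^sup>T v = 0\<close> and so \<open>v = 0\<close>.\<close>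
lemma mat_inverse_one_plus_gram:
  fixes W :: "real mat"
  assumes W: "W \<in> carrier_mat l k"
  obtains Z where "mat_inverse (1\<^sub>m l + W * W\<^sup>T) = Some Z" "Z \<in> carrier_mat l l"
    "(1\<^sub>m l + W * W\<^sup>T) * Z = 1\<^sub>m l" "Z * (1\<^sub>m l + W * W\<^sup>T) = 1\<^sub>m l"
proof -
  let ?G = "1\<^sub>m l + W * W\<^sup>T"
  have G: "?G \<in> carrier_mat l l" using W by auto
  have "v = 0\<^sub>v l" if v: "v \<in> carrier_vec l" and z: "?G *\<^sub>v v = 0\<^sub>v l" for v
  proof -
    have "?G *\<^sub>v v = v + W *\<^sub>v (W\<^sup>T *\<^sub>v v)"
      using v W by (simp add: add_mult_distrib_mat_vec[of _ l l] assoc_mult_mat_vec[of _ l k _ l])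
    then have "0 = v \<bullet> (v + W *\<^sub>v (W\<^sup>T *\<^sub>v v))"
      using scalar_prod_right_zero[OF v] z by simp
    also have "\<dots> = v \<bullet> v + v \<bullet> (W *\<^sub>v (W\<^sup>T *\<^sub>v v))"
      using v W by (intro scalar_prod_add_distrib[of _ l]) auto
    also have "v \<bullet> (W *\<^sub>v (W\<^sup>T *\<^sub>v v)) = (W\<^sup>T *\<^sub>v v) \<bullet> (W\<^sup>T *\<^sub>v v)"
      using v W by (intro transpose_vec_mult_scalar[symmetric]) auto
    finally have "v \<bullet> v = 0"
      using scalar_prod_self_ge_0[of v] scalar_prod_self_ge_0[of "W\<^sup>T *\<^sub>v v"] by linarith
    then show ?thesis using v by (rule scalar_prod_self_eq_0)
  qed
  then have "det ?G \<noteq> 0" using det_0_iff_vec_prod_zero_field[OF G] by blast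
  then have "?G \<in> Units (ring_mat TYPE(real) l ())" by (rule det_non_zero_imp_unit[OF G])
  then obtain Z where "mat_inverse ?G = Some Z" using mat_inverse(1)[OF G] by fastforce
  then show ?thesis using that mat_inverse(2)[OF G] by blast
qed

text \<open>The matrix whose inverse is \<open>Z\<close> in Cline's formula has the form \<open>I + W W\<^sup>T\<close> with
  \<open>W = F Q P\<close>, because \<open>F\<close> is symmetric.\<close>
lemma mat_inverse_cline:
  fixes F Q P :: "real mat"
  assumes "F \<in> carrier_mat l l" "F\<^sup>T = F" "Q \<in> carrier_mat l d" "P \<in> carrier_mat d k"
  obtains Z where "mat_inverse (1\<^sub>m l + F * Q * P * P\<^sup>T * Q\<^sup>T * F) = Some Z" "Z \<in> carrier_mat l l"
    "(1\<^sub>m l + F * Q * P * P\<^sup>T * Q\<^sup>T * F) * Z = 1\<^sub>m l"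
    "Z * (1\<^sub>m l + F * Q * P * P\<^sup>T * Q\<^sup>T * F) = 1\<^sub>m l"
proof -
  have "F * Q * P \<in> carrier_mat l k" using assms by auto
  moreover have "F * Q * P * P\<^sup>T * Q\<^sup>T * F = (F * Q * P) * (F * Q * P)\<^sup>T"
    using assms by (simp add: mult_assoc_dims transpose_mult_dims)
  ultimately show ?thesis using mat_inverse_one_plus_gram[of "F * Q * P" l k] that by metis
qed

text \<open>A nonzero column \<open>v\<close> has the inverse \<open>v\<^sup>T / (v \<bullet> v)\<close>.\<close>
lemma is_pinv_column_ex:
  fixes R :: "real mat"
  assumes R: "R \<in> carrier_mat d 1"
  shows "\<exists>S. is_pinv R S"
proof -
  define c where "c = col R 0 \<bullet> col R 0"
  have RR: "R\<^sup>T * R = c \<cdot>\<^sub>m 1\<^sub>m 1"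
    using R by (intro eq_matI) (auto simp: c_def)
  show ?thesis
  proof (cases "c = 0")
    case True
    then have "col R 0 = 0\<^sub>v d" using R by (intro scalar_prod_self_eq_0) (auto simp: c_def)
    have "R $$ (i, 0) = 0" if "i < d" for i
    proof -
      have "R $$ (i, 0) = col R 0 $ i" using R that by simp
      then show ?thesis using \<open>col R 0 = 0\<^sub>v d\<close> that by simp
    qed
    then have "R = 0\<^sub>m d 1" using R by (intro eq_matI) auto
    then have "is_pinv R (0\<^sub>m 1 d)" by (auto simp: is_pinv_def)
    then show ?thesis by blast
  next
    case False
    have [simp]: "dim_row R = d" "dim_col R = 1" using R by auto
    let ?S = "inverse c \<cdot>\<^sub>m R\<^sup>T"
    have SR: "?S * R = 1\<^sub>m 1"
    proof -
      have "?S * R = inverse c \<cdot>\<^sub>m (R\<^sup>T * R)"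
        using R by (intro mult_smult_assoc_mat[of _ 1 d _ 1]) auto
      then show ?thesis using False by (simp add: RR) (intro eq_matI, auto)
    qed
    have RS: "(R * ?S)\<^sup>T = R * ?S"
      using R by (intro eq_matI) (auto simp: scalar_prod_def)
    have "R * ?S * R = R" by (subst mult_assoc_dims) (simp_all add: SR mult_one_dims)
    moreover have "?S * R * ?S = ?S" unfolding SR by (rule one_mult_dims) simp
    ultimately have "is_pinv R ?S" using RS unfolding is_pinv_def SR by auto
    then show ?thesis by blast
  qed
qed

text \<open>Cline's formula reduces the inverse of a matrix to those of its upper rows \<open>Q1\<close> and of a
  matrix \<open>R\<close> with as many columns as \<open>Q2\<close> has rows. Splitting off one row at a time, \<open>R\<close> is a
  single column, so induction on the number of rows gives existence.\<close>
lemma is_pinv_ex: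
  fixes A :: "real mat"
  assumes "A \<in> carrier_mat n d"
  shows "\<exists>X. is_pinv A X"
  using assms
proof (induction n arbitrary: A)
  case 0
  then have "is_pinv A (0\<^sub>m d 0)" by (auto simp: is_pinv_def intro!: eq_matI)
  then show ?case by blast
next
  case (Suc n)
  define Q1 where "Q1 = mat n d (\<lambda>(i, j). A $$ (i, j))"
  define Q2 where "Q2 = mat 1 d (\<lambda>(i, j). A $$ (n, j))"
  have Q: "Q1 \<in> carrier_mat n d" "Q2 \<in> carrier_mat 1 d" by (auto simp: Q1_def Q2_def)
  have A: "A = Q1 @\<^sub>r Q2"
    using Suc.prems by (intro eq_matI) (auto simp: append_rows_index Q1_def Q2_def less_Suc_eq)
  obtain P where P: "is_pinv Q1 P" using Suc.IH[OF Q(1)] by blast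
  define R where "R = (1\<^sub>m d - P * Q1) * Q2\<^sup>T"
  have R: "R \<in> carrier_mat d 1" using P Q by (auto simp: R_def is_pinv_def)
  then obtain S where S: "is_pinv R S" using is_pinv_column_ex by blast
  let ?F = "1\<^sub>m 1 - S * R"
  have d: "dim_row P = d" "dim_col P = n" "dim_row S = 1" "dim_col S = d" "dim_col R = 1" "dim_row Q2 = 1" "dim_col Q2 = d"
    using P Q S R by (auto simp: is_pinv_def)
  have F: "?F \<in> carrier_mat 1 1" "?F\<^sup>T = ?F"
    using S d by (auto simp: transpose_minus_dims is_pinv_def)
  have "P \<in> carrier_mat d n" using d by auto
  from mat_inverse_cline[OF F Q(2) this] obtain Z where Z: "Z \<in> carrier_mat 1 1"
    "(1\<^sub>m 1 + ?F * Q2 * P * P\<^sup>T * Q2\<^sup>T * ?F) * Z = 1\<^sub>m 1"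
    "Z * (1\<^sub>m 1 + ?F * Q2 * P * P\<^sup>T * Q2\<^sup>T * ?F) = 1\<^sub>m 1"
    by blast
  note S' = S[unfolded R_def]
  note c1 = is_pinv_append_rows(1)[OF Q P S']
  note c2 = c1[folded R_def]
  note c3 = c2[OF Z(1,3,2)]
  from c3 have "\<exists>X. is_pinv (Q1 @\<^sub>r Q2) X" by (rule exI)
  then show ?case by (simp only: A)
qed

lemma is_pinv_pinv: "is_pinv A (A\<^sup>\<dagger>)"
proof -
  have "\<exists>!X. is_pinv A X"
    using is_pinv_ex[OF carrier_matI[OF refl refl, of A]] is_pinv_unique by metis
  then show ?thesis unfolding pinv_def by (rule theI')
qed

lemma pinv_dim [simp]: "dim_row (A\<^sup>\<dagger>) = dim_col A" "dim_col (A\<^sup>\<dagger>) = dim_row A"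
  using carrier_matD[OF is_pinvD(1)[OF is_pinv_pinv[of A]]] by auto

lemma pinv_eqI: "is_pinv A X \<Longrightarrow> A\<^sup>\<dagger> = X"
  by (rule is_pinv_unique[OF is_pinv_pinv])

lemma pinv_append_rows:
  fixes Q1 Q2 R Z H :: "real mat"
  assumes Q1: "Q1 \<in> carrier_mat k d" and Q2: "Q2 \<in> carrier_mat l d"
    and R: "R = (1\<^sub>m d - Q1\<^sup>\<dagger> * Q1) * Q2\<^sup>T"
    and Z: "Z = the (mat_inverse (1\<^sub>m l
               + (1\<^sub>m l - R\<^sup>\<dagger> * R) * Q2 * Q1\<^sup>\<dagger> * (Q1\<^sup>\<dagger>)\<^sup>T * Q2\<^sup>T * (1\<^sub>m l - R\<^sup>\<dagger> * R)))"
    and H: "H = R\<^sup>\<dagger> + (1\<^sub>m l - R\<^sup>\<dagger> * R) * Z * Q2 * Q1\<^sup>\<dagger> * (Q1\<^sup>\<dagger>)\<^sup>T * (1\<^sub>m d - Q2\<^sup>T * R\<^sup>\<dagger>)"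
  shows "(Q1 @\<^sub>r Q2)\<^sup>\<dagger> = join_cols (Q1\<^sup>\<dagger> - H\<^sup>T * Q2 * Q1\<^sup>\<dagger>) (H\<^sup>T)"
    and "(Q1 @\<^sub>r Q2)\<^sup>\<dagger> * (Q1 @\<^sub>r Q2) = Q1\<^sup>\<dagger> * Q1 + R * R\<^sup>\<dagger>"
proof -
  let ?F = "1\<^sub>m l - R\<^sup>\<dagger> * R"
  note P = is_pinv_pinv[of Q1] and S = is_pinv_pinv[of R]
  have dR: "dim_col R = l" "dim_row R = d" using Q1 Q2 by (simp_all add: R)
  have ST: "(R\<^sup>\<dagger> * R)\<^sup>T = R\<^sup>\<dagger> * R" by (rule is_pinvD(5)[OF S])
  have F: "?F \<in> carrier_mat l l" "?F\<^sup>T = ?F"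
    subgoal by (rule carrier_matI; simp add: dR)
    subgoal by (rule trans[OF transpose_minus_dims]) (simp_all only: ST dR index_mult_mat index_one_mat pinv_dim transpose_one)
    done
  have Pc: "Q1\<^sup>\<dagger> \<in> carrier_mat d k" using Q1 by (intro carrier_matI) simp_all
  obtain Z' where Z': "mat_inverse (1\<^sub>m l + ?F * Q2 * Q1\<^sup>\<dagger> * (Q1\<^sup>\<dagger>)\<^sup>T * Q2\<^sup>T * ?F) = Some Z'"
    "Z' \<in> carrier_mat l l" "(1\<^sub>m l + ?F * Q2 * Q1\<^sup>\<dagger> * (Q1\<^sup>\<dagger>)\<^sup>T * Q2\<^sup>T * ?F) * Z' = 1\<^sub>m l"
    "Z' * (1\<^sub>m l + ?F * Q2 * Q1\<^sup>\<dagger> * (Q1\<^sup>\<dagger>)\<^sup>T * Q2\<^sup>T * ?F) = 1\<^sub>m l"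
    by (rule mat_inverse_cline[OF F Q2 Pc])
  have ZZ: "Z = Z'" unfolding Z Z'(1) by simp
  note cline = is_pinv_append_rows[OF Q1 Q2 P S[unfolded R], folded R, OF Z'(2,4,3), folded ZZ, folded H]
  show eq: "(Q1 @\<^sub>r Q2)\<^sup>\<dagger> = join_cols (Q1\<^sup>\<dagger> - H\<^sup>T * Q2 * Q1\<^sup>\<dagger>) (H\<^sup>T)"
    by (rule pinv_eqI[OF cline(1)])
  show "(Q1 @\<^sub>r Q2)\<^sup>\<dagger> * (Q1 @\<^sub>r Q2) = Q1\<^sup>\<dagger> * Q1 + R * R\<^sup>\<dagger>"
    unfolding eq by (rule cline(2))
qed

section \<open>Real linear systems\<close>

lemma linear_system_solvable_iff:
  fixes V :: "real mat"
  assumes V: "V \<in> carrier_mat N d" and e: "e \<in> carrier_vec N"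
  shows "(\<exists>y\<in>carrier_vec d. V *\<^sub>v y = e) \<longleftrightarrow> (V * V\<^sup>\<dagger>) *\<^sub>v e = e"
proof
  have P: "V\<^sup>\<dagger> \<in> carrier_mat d N" using V by (intro carrier_matI) simp_all
  assume "\<exists>y\<in>carrier_vec d. V *\<^sub>v y = e"
  then obtain y where y: "y \<in> carrier_vec d" "V *\<^sub>v y = e" by blast
  have "(V * V\<^sup>\<dagger>) *\<^sub>v e = (V * V\<^sup>\<dagger> * V) *\<^sub>v y"
    unfolding y(2)[symmetric]
    by (rule assoc_mult_mat_vec[symmetric, OF mult_carrier_mat[OF V P] V y(1)])
  then show "(V * V\<^sup>\<dagger>) *\<^sub>v e = e" by (simp only: is_pinvD(2)[OF is_pinv_pinv] y)
next
  have P: "V\<^sup>\<dagger> \<in> carrier_mat d N" using V by (intro carrier_matI) simp_all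
  assume "(V * V\<^sup>\<dagger>) *\<^sub>v e = e"
  then have "V *\<^sub>v (V\<^sup>\<dagger> *\<^sub>v e) = e" by (simp only: assoc_mult_mat_vec[OF V P e])
  then show "\<exists>y\<in>carrier_vec d. V *\<^sub>v y = e"
    using mult_mat_vec_carrier[OF P e] by blast
qed

lemma linear_system_solutions:
  fixes V :: "real mat"
  assumes V: "V \<in> carrier_mat N d" and e: "e \<in> carrier_vec N" and c: "(V * V\<^sup>\<dagger>) *\<^sub>v e = e"
  shows "{y \<in> carrier_vec d. V *\<^sub>v y = e} =
    {V\<^sup>\<dagger> *\<^sub>v e + (1\<^sub>m d - V\<^sup>\<dagger> * V) *\<^sub>v z | z. z \<in> carrier_vec d}" (is "?L = ?R")
proof -
  have P: "V\<^sup>\<dagger> \<in> carrier_mat d N" using V by (intro carrier_matI) simp_all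
  have PV: "V\<^sup>\<dagger> * V \<in> carrier_mat d d" by (rule mult_carrier_mat[OF P V])
  have K: "1\<^sub>m d - V\<^sup>\<dagger> * V \<in> carrier_mat d d" using PV by (rule minus_carrier_mat)
  have VK: "V * (1\<^sub>m d - V\<^sup>\<dagger> * V) = 0\<^sub>m N d"
    using V is_pinvD(2)[OF is_pinv_pinv, of V] by (simp add: mat_dims_simps)
  show ?thesis
  proof (intro equalityI subsetI)
    fix y assume "y \<in> ?L"
    then have y: "y \<in> carrier_vec d" "V *\<^sub>v y = e" by auto
    have "V\<^sup>\<dagger> *\<^sub>v e + (1\<^sub>m d - V\<^sup>\<dagger> * V) *\<^sub>v y = V\<^sup>\<dagger> *\<^sub>v e + (y - V\<^sup>\<dagger> *\<^sub>v e)"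
      using minus_mult_distrib_mat_vec[OF one_carrier_mat PV y(1)] assoc_mult_mat_vec[OF P V y(1)] y by simp
    also have "\<dots> = y" using y P by (intro eq_vecI) auto
    finally show "y \<in> ?R" using y by (metis (mono_tags, lifting) mem_Collect_eq)
  next
    fix y assume "y \<in> ?R"
    then obtain z where z: "z \<in> carrier_vec d" and y: "y = V\<^sup>\<dagger> *\<^sub>v e + (1\<^sub>m d - V\<^sup>\<dagger> * V) *\<^sub>v z" by blast
    have "V *\<^sub>v y = V *\<^sub>v (V\<^sup>\<dagger> *\<^sub>v e) + V *\<^sub>v ((1\<^sub>m d - V\<^sup>\<dagger> * V) *\<^sub>v z)"
      unfolding y by (rule mult_add_distrib_mat_vec[OF V mult_mat_vec_carrier[OF P e] mult_mat_vec_carrier[OF K z]])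
    also have "V *\<^sub>v (V\<^sup>\<dagger> *\<^sub>v e) = e" using c by (simp only: assoc_mult_mat_vec[OF V P e])
    also have "V *\<^sub>v ((1\<^sub>m d - V\<^sup>\<dagger> * V) *\<^sub>v z) = 0\<^sub>v N"
    proof -
      have "0\<^sub>m N d *\<^sub>v z = 0\<^sub>v N" using z by (intro eq_vecI) auto
      then show ?thesis using assoc_mult_mat_vec[OF V K z] by (simp only: VK)
    qed
    finally have "V *\<^sub>v y = e" using e by simp
    moreover have "y \<in> carrier_vec d"
      unfolding y by (rule add_carrier_vec[OF mult_mat_vec_carrier[OF P e] mult_mat_vec_carrier[OF K z]])
    ultimately show "y \<in> ?L" by blast
  qed
qed

lemma mat_mult_unit_vec:
  fixes V :: "'a :: semiring_1 mat"
  assumes "V \<in> carrier_mat N d" "i < d"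
  shows "V *\<^sub>v unit_vec d i = col V i"
  using assms by (intro eq_vecI) auto

lemma kernel_trivial_imp_distinct_cols:
  fixes V :: "'a :: field mat"
  assumes V: "V \<in> carrier_mat N d"
    and ker: "\<And>y. y \<in> carrier_vec d \<Longrightarrow> V *\<^sub>v y = 0\<^sub>v N \<Longrightarrow> y = 0\<^sub>v d"
  shows "distinct (cols V)"
proof -
  have "col V i \<noteq> col V j" if ij: "i < d" "j < d" "i \<noteq> j" for i j
  proof
    assume eq: "col V i = col V j"
    have "V *\<^sub>v (unit_vec d i - unit_vec d j) = col V i - col V j"
      using mult_minus_distrib_mat_vec[OF V, of "unit_vec d i" "unit_vec d j"] mat_mult_unit_vec[OF V] ij by simp
    also have "\<dots> = 0\<^sub>v N" using V by (intro eq_vecI) (auto simp: eq)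
    finally have "unit_vec d i - unit_vec d j = (0\<^sub>v d :: 'a vec)" by (intro ker) auto
    from arg_cong[OF this, of "\<lambda>v. v $ i"] show False using ij by simp
  qed
  then show ?thesis using V by (auto simp: distinct_conv_nth)
qed

text \<open>Linear independence of the set of columns says something about the kernel only if the columns are
  distinct. Full rank guarantees this because the rank is at most the number of different columns,
  a trivial kernel because two equal columns yield the kernel vector \<open>e\<^sub>i - e\<^sub>j\<close>.\<close>
lemma rank_eq_dim_col_iff:
  fixes V :: "real mat"
  assumes V: "V \<in> carrier_mat N d"
  shows "vec_space.rank N V = d \<longleftrightarrow> (\<forall>y\<in>carrier_vec d. V *\<^sub>v y = 0\<^sub>v N \<longrightarrow> y = 0\<^sub>v d)"
proof -
  interpret vec_space "TYPE(real)" N .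
  show ?thesis
  proof
    assume r: "rank V = d"
    obtain S where S: "maximal S (\<lambda>T. T \<subseteq> set (cols V) \<and> lin_indpt T)"
      using maximal_exists[of "(\<lambda>T. T \<subseteq> set (cols V) \<and> lin_indpt T)" "card (set (cols V))" "{}"]
      by (meson List.finite_set card_mono empty_iff empty_subsetI finite_lin_indpt2 rev_finite_subset)
    then have "d = card S" using rank_card_indpt[OF V S] r by simp
    also have "\<dots> \<le> card (set (cols V))" using S by (simp add: card_mono maximal_def)
    finally have "distinct (cols V)"
      using V by (intro card_distinct) (metis card_length carrier_matD(2) cols_length le_antisym)
    then show "\<forall>y\<in>carrier_vec d. V *\<^sub>v y = 0\<^sub>v N \<longrightarrow> y = 0\<^sub>v d"
      using full_rank_lin_indpt[OF V r] lin_depI[OF V] by blast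
  next
    assume ker: "\<forall>y\<in>carrier_vec d. V *\<^sub>v y = 0\<^sub>v N \<longrightarrow> y = 0\<^sub>v d"
    then have "distinct (cols V)" using kernel_trivial_imp_distinct_cols[OF V] by blast
    then show "rank V = d" using ker lin_depE[OF V] lin_indpt_full_rank[OF V] by metis
  qed
qed

lemma linear_system_unique_iff:
  fixes V :: "real mat"
  assumes V: "V \<in> carrier_mat N d" and y0: "y0 \<in> carrier_vec d" "V *\<^sub>v y0 = e"
  shows "(\<exists>!y. y \<in> {y \<in> carrier_vec d. V *\<^sub>v y = e}) \<longleftrightarrow> vec_space.rank N V = d"
proof -
  have e: "e \<in> carrier_vec N" using mult_mat_vec_carrier[OF V y0(1)] y0(2) by simp
  show ?thesis
    unfolding rank_eq_dim_col_iff[OF V]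
  proof
    assume ex1: "\<exists>!y. y \<in> {y \<in> carrier_vec d. V *\<^sub>v y = e}"
    show "\<forall>w\<in>carrier_vec d. V *\<^sub>v w = 0\<^sub>v N \<longrightarrow> w = 0\<^sub>v d"
    proof (intro ballI impI)
      fix w assume w: "w \<in> carrier_vec d" "V *\<^sub>v w = 0\<^sub>v N"
      have "V *\<^sub>v (y0 + w) = e"
        using mult_add_distrib_mat_vec[OF V y0(1) w(1)] y0 w e by simp
      moreover have "y0 + w \<in> carrier_vec d" using y0 w by simp
      ultimately have "y0 + w = y0" using ex1 y0 by blast
      then have "y0 $ i + w $ i = y0 $ i" if "i < d" for i
        using that w y0 by (metis carrier_vecD index_add_vec(1))
      then show "w = 0\<^sub>v d" using w by (intro eq_vecI) auto
    qed
  next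
    assume ker: "\<forall>w\<in>carrier_vec d. V *\<^sub>v w = 0\<^sub>v N \<longrightarrow> w = 0\<^sub>v d"
    have "y = y0" if y: "y \<in> carrier_vec d" "V *\<^sub>v y = e" for y
    proof -
      have "V *\<^sub>v (y - y0) = 0\<^sub>v N"
        using mult_minus_distrib_mat_vec[OF V y(1) y0(1)] y y0 e by simp
      moreover have "y - y0 \<in> carrier_vec d" using y y0 by simp
      ultimately have "y - y0 = 0\<^sub>v d" using ker by blast
      then have "(y - y0) $ i = 0" if "i < d" for i using that by simp
      then show ?thesis using y y0 by (intro eq_vecI) auto
    qed
    then show "\<exists>!y. y \<in> {y \<in> carrier_vec d. V *\<^sub>v y = e}" using y0 by blast
  qed
qed

section \<open>Vectorization and the Kronecker product\<close>

lemma stack_vecs_simps [simp]: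
  "stack_vecs [] = vNil" "stack_vecs (v # vs) = v @\<^sub>v stack_vecs vs"
  by (simp_all add: stack_vecs_def)

lemma dim_stack_vecs: "dim_vec (stack_vecs vs) = (\<Sum>v\<leftarrow>vs. dim_vec v)"
  by (induction vs) auto

lemma append_vec_assoc: "(u @\<^sub>v v) @\<^sub>v w = u @\<^sub>v (v @\<^sub>v w)"
  by (intro eq_vecI) auto

lemma stack_vecs_append: "stack_vecs (us @ vs) = stack_vecs us @\<^sub>v stack_vecs vs"
  by (induction us) (simp_all add: append_vec_assoc)

lemma index_stack_vecs_equal:
  assumes "\<And>v. v \<in> set vs \<Longrightarrow> dim_vec v = nr" "i < nr" "j < length vs"
  shows "stack_vecs vs $ (j * nr + i) = vs ! j $ i"
  using assms
proof (induction vs arbitrary: j)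
  case (Cons v vs)
  have d: "dim_vec (stack_vecs vs) = nr * length vs"
    using Cons.prems(1) by (simp add: dim_stack_vecs sum_list_triv cong: map_cong)
  show ?case
  proof (cases j)
    case 0
    then show ?thesis using Cons.prems d by simp
  next
    case (Suc j')
    have "j' * nr + i < length vs * nr"
      using Cons.prems Suc mult_le_mono1[of "Suc j'" "length vs" nr] by simp
    then show ?thesis using Cons.prems Cons.IH[of j'] d Suc by (simp add: mult.commute)
  qed
qed simp

lemma dim_vec_mat [simp]: "dim_vec (vec_mat A) = dim_row A * dim_col A"
proof -
  have "map dim_vec (cols A) = map (\<lambda>v. dim_row A) (cols A)"
    by (intro map_cong refl) (auto simp: cols_def)
  then have "sum_list (map dim_vec (cols A)) = (\<Sum>v\<leftarrow>cols A. dim_row A)" by (rule arg_cong)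
  then show ?thesis by (simp only: vec_mat_def dim_stack_vecs sum_list_triv) simp
qed

lemma index_vec_mat:
  assumes "i < dim_row A" "j < dim_col A"
  shows "vec_mat A $ (j * dim_row A + i) = A $$ (i, j)"
  unfolding vec_mat_def using assms
  by (subst index_stack_vecs_equal) (auto simp: cols_def)

lemma index_vec_mat':
  assumes "k < dim_row A * dim_col A"
  shows "vec_mat A $ k = A $$ (k mod dim_row A, k div dim_row A)"
proof -
  have "dim_row A > 0" using assms by (cases "dim_row A") auto
  then have "k mod dim_row A < dim_row A" "k div dim_row A < dim_col A"
    using assms by (auto simp: less_mult_imp_div_less mult.commute)
  from index_vec_mat[OF this] show ?thesis by simp
qed

lemma vec_mat_eqI:
  assumes "dim_row A = dim_row B" "dim_col A = dim_col B" "vec_mat A = vec_mat B"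
  shows "A = B"
proof (intro eq_matI)
  fix i j assume "i < dim_row B" "j < dim_col B"
  then show "A $$ (i, j) = B $$ (i, j)"
    using index_vec_mat[of i A j] index_vec_mat[of i B j] assms by simp
qed (use assms in simp_all)

lemma vec_mat_map: "vec_mat (map_mat f A) = map_vec f (vec_mat A)"
proof (intro eq_vecI)
  fix k assume "k < dim_vec (map_vec f (vec_mat A))"
  then have k: "k < dim_row A * dim_col A" by simp
  then have "dim_row A > 0" by (cases "dim_row A") auto
  with k show "vec_mat (map_mat f A) $ k = map_vec f (vec_mat A) $ k"
    by (simp add: index_vec_mat' less_mult_imp_div_less mult.commute)
qed simp

lemma vec_mat_join_cols:
  assumes "dim_row A = dim_row B"
  shows "vec_mat (join_cols A B) = vec_mat A @\<^sub>v vec_mat B"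
proof -
  have "cols (join_cols A B) = cols A @ cols B"
  proof (intro nth_equalityI)
    fix j assume "j < length (cols (join_cols A B))"
    then have j: "j < dim_col A + dim_col B" by simp
    show "cols (join_cols A B) ! j = (cols A @ cols B) ! j"
      using j assms by (intro eq_vecI) (auto simp: nth_append join_cols_index)
  qed simp
  then show ?thesis by (simp add: vec_mat_def stack_vecs_append)
qed

lemma vec_mat_no_cols [simp]: "dim_col A = 0 \<Longrightarrow> vec_mat A = vNil"
  by (simp add: vec_mat_def cols_def)

lemma sum_div_mod:
  fixes f :: "nat \<Rightarrow> nat \<Rightarrow> 'a :: comm_monoid_add"
  shows "(\<Sum>c<s * n. f (c div n) (c mod n)) = (\<Sum>q<s. \<Sum>p<n. f q p)"
proof -
  have "(\<Sum>c\<in>{q * n..<q * n + n}. f (c div n) (c mod n)) = (\<Sum>p<n. f q p)" for q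
    using sum.shift_bounds_nat_ivl[of "\<lambda>c. f (c div n) (c mod n)" 0 "q * n" n]
    by (cases "n = 0") (simp_all add: add.commute atLeast0LessThan)
  then show ?thesis by (simp flip: sum.nat_group)
qed

text \<open>At position \<open>j m + i\<close> both sides are \<open>\<Sum>\<^sub>q \<Sum>\<^sub>p A\<^sub>i\<^sub>p X\<^sub>p\<^sub>q B\<^sub>q\<^sub>j\<close>: the single summation index \<open>c\<close> of
  the left-hand side encodes the pair \<open>(p, q)\<close> as \<open>c = q n + p\<close>.\<close>
lemma kronecker_mult_vec_mat:
  fixes A X B :: "'a :: comm_ring_1 mat"
  assumes A: "A \<in> carrier_mat m n" and X: "X \<in> carrier_mat n s" and B: "B \<in> carrier_mat s t"
  shows "(B\<^sup>T \<otimes>\<^sub>K A) *\<^sub>v vec_mat X = vec_mat (A * X * B)"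
proof (intro eq_vecI)
  have d [simp]: "dim_row A = m" "dim_col A = n" "dim_row X = n" "dim_col X = s" "dim_row B = s" "dim_col B = t"
    using assms by auto
  show "dim_vec ((B\<^sup>T \<otimes>\<^sub>K A) *\<^sub>v vec_mat X) = dim_vec (vec_mat (A * X * B))"
    by (simp add: kronecker_def)
  fix k assume "k < dim_vec (vec_mat (A * X * B))"
  then have k: "k < m * t" by simp
  then have m: "m > 0" by (cases m) auto
  define i j where "i = k mod m" and "j = k div m"
  have i: "i < m" and j: "j < t" using k m by (auto simp: i_def j_def less_mult_imp_div_less mult.commute)
  have "((B\<^sup>T \<otimes>\<^sub>K A) *\<^sub>v vec_mat X) $ k =
    (\<Sum>c<s * n. B $$ (c div n, j) * A $$ (i, c mod n) * X $$ (c mod n, c div n))"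
  proof -
    have "((B\<^sup>T \<otimes>\<^sub>K A) *\<^sub>v vec_mat X) $ k =
      (\<Sum>c<s * n. (B\<^sup>T \<otimes>\<^sub>K A) $$ (k, c) * vec_mat X $ c)"
      using k by (auto simp: scalar_prod_def kronecker_def mult.commute[of m] mult.commute[of s] atLeast0LessThan intro!: sum.cong)
    also have "\<dots> = (\<Sum>c<s * n. B $$ (c div n, j) * A $$ (i, c mod n) * X $$ (c mod n, c div n))"
    proof (intro sum.cong refl)
      fix c assume "c \<in> {..<s * n}"
      then have c: "c < s * n" by simp
      then have "c div n < s" by (simp add: less_mult_imp_div_less)
      then show "(B\<^sup>T \<otimes>\<^sub>K A) $$ (k, c) * vec_mat X $ c =
        B $$ (c div n, j) * A $$ (i, c mod n) * X $$ (c mod n, c div n)"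
        using c k j by (simp add: kronecker_def index_vec_mat' i_def j_def mult.commute[of m] mult.commute[of s])
    qed
    finally show ?thesis .
  qed
  also have "\<dots> = (\<Sum>q<s. \<Sum>p<n. B $$ (q, j) * A $$ (i, p) * X $$ (p, q))"
    by (rule sum_div_mod)
  also have "\<dots> = (\<Sum>q<s. (A * X) $$ (i, q) * B $$ (q, j))"
    using i by (auto simp: scalar_prod_def sum_distrib_left sum_distrib_right atLeast0LessThan mult_ac intro!: sum.cong)
  also have "\<dots> = (A * X * B) $$ (i, j)"
    using i j by (subst index_mult_mat(1)) (auto simp: scalar_prod_def atLeast0LessThan intro!: sum.cong simp del: index_mult_mat(1))
  also have "\<dots> = vec_mat (A * X * B) $ k"
    using k by (simp add: index_vec_mat' i_def j_def del: index_mult_mat(1))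
  finally show "((B\<^sup>T \<otimes>\<^sub>K A) *\<^sub>v vec_mat X) $ k = vec_mat (A * X * B) $ k" .
qed

lemma join_cols_mult_vec:
  fixes A B :: "'a :: semiring_0 mat"
  assumes "A \<in> carrier_mat nr a" "B \<in> carrier_mat nr b" "u \<in> carrier_vec a" "v \<in> carrier_vec b"
  shows "join_cols A B *\<^sub>v (u @\<^sub>v v) = A *\<^sub>v u + B *\<^sub>v v"
proof -
  have "join_cols A B *\<^sub>v (u @\<^sub>v v) = (A *\<^sub>v u + B *\<^sub>v v) @\<^sub>v (0\<^sub>m 0 a *\<^sub>v u + 0\<^sub>m 0 b *\<^sub>v v)"
    unfolding join_cols_def using assms by (subst four_block_mat_mult_vec[of _ nr a _ b _ 0]) auto
  also have "\<dots> = A *\<^sub>v u + B *\<^sub>v v"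
    using assms by (intro eq_vecI) auto
  finally show ?thesis .
qed

section \<open>Reduced biquaternion matrices as complex and real matrices\<close>

lemma vec_mat_add:
  assumes "A \<in> carrier_mat m n" "B \<in> carrier_mat m n"
  shows "vec_mat (A + B) = vec_mat A + vec_mat B"
proof (intro eq_vecI)
  fix k assume "k < dim_vec (vec_mat A + vec_mat B)"
  then have k: "k < m * n" using assms by simp
  then have "m > 0" by (cases m) auto
  then have "k mod m < m" "k div m < n" using k by (auto simp: less_mult_imp_div_less mult.commute)
  then show "vec_mat (A + B) $ k = (vec_mat A + vec_mat B) $ k"
    using k assms by (simp add: index_vec_mat')
qed (use assms in simp)

lemma block_row_simps [simp]:
  "block_row nr [] = 0\<^sub>m nr 0" "block_row nr (A # As) = join_cols A (block_row nr As)"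
  by (simp_all add: block_row_def)

lemma join_cols_empty [simp]: "dim_row A = nr \<Longrightarrow> join_cols A (0\<^sub>m nr 0) = A"
  by (intro eq_matI) (auto simp: join_cols_index)

lemma Psi_eq: "Psi Z = join_cols (map_mat cpart1 Z) (map_mat cpart2 Z)"
  by (simp add: Psi_def)

lemma cpart_simps [simp]:
  "cpart1 0 = 0" "cpart2 0 = 0" "cpart1 (x + y) = cpart1 x + cpart1 y" "cpart2 (x + y) = cpart2 x + cpart2 y"
  "cpart1 (x * y) = cpart1 x * cpart1 y + cpart2 x * cpart2 y"
  "cpart2 (x * y) = cpart1 x * cpart2 y + cpart2 x * cpart1 y"
  by (simp_all add: cpart1_def cpart2_def rbq_defs complex_eq_iff)

lemma cpart_sum: "cpart1 (sum f I) = (\<Sum>i\<in>I. cpart1 (f i))" "cpart2 (sum f I) = (\<Sum>i\<in>I. cpart2 (f i))"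
  by (induction I rule: infinite_finite_induct) auto

lemma cpart_eqI: "cpart1 x = cpart1 y \<Longrightarrow> cpart2 x = cpart2 y \<Longrightarrow> x = y"
  by (simp add: cpart1_def cpart2_def rbq_eq_iff)

lemma map_mat_cpart_mult:
  assumes "dim_col A = dim_row B"
  shows "map_mat cpart1 (A * B) = map_mat cpart1 A * map_mat cpart1 B + map_mat cpart2 A * map_mat cpart2 B"
    and "map_mat cpart2 (A * B) = map_mat cpart1 A * map_mat cpart2 B + map_mat cpart2 A * map_mat cpart1 B"
  using assms by (auto intro!: eq_matI simp: scalar_prod_def cpart_sum sum.distrib)

lemma join_cols_mult_four_block:
  fixes A B C D E F :: "'a :: semiring_0 mat"
  assumes "A \<in> carrier_mat m a" "B \<in> carrier_mat m b"
    "C \<in> carrier_mat a c" "D \<in> carrier_mat a d" "E \<in> carrier_mat b c" "F \<in> carrier_mat b d"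
  shows "join_cols A B * four_block_mat C D E F = join_cols (A * C + B * E) (A * D + B * F)"
proof -
  have "join_cols A B * four_block_mat C D E F =
    four_block_mat (A * C + B * E) (A * D + B * F) (0\<^sub>m 0 a * C + 0\<^sub>m 0 b * E) (0\<^sub>m 0 a * D + 0\<^sub>m 0 b * F)"
    unfolding join_cols_def using assms by (subst mult_four_block_mat[of _ m a _ b _ 0 _ _ c _ d]) auto
  also have "\<dots> = join_cols (A * C + B * E) (A * D + B * F)"
    unfolding join_cols_def using assms by (intro cong_four_block_mat eq_matI) auto
  finally show ?thesis .
qed

lemma add_join_cols:
  fixes A B C D :: "'a :: semiring_0 mat"
  assumes "A \<in> carrier_mat m a" "B \<in> carrier_mat m b" "C \<in> carrier_mat m a" "D \<in> carrier_mat m b"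
  shows "join_cols A B + join_cols C D = join_cols (A + C) (B + D)"
  using assms by (intro eq_matI) (auto simp: join_cols_index)

text \<open>Since \<open>j\<^sup>2 = 1\<close> and \<open>j\<close> is central, \<open>\<Psi>\<close> turns right multiplication by \<open>B\<close> into right
  multiplication by \<open>hrep B\<close>, and left multiplication by \<open>j\<close> exchanges the two blocks of \<open>\<Psi> X\<close>. The second
  effect can be moved to the right factor, where it turns \<open>hrep B\<close> into \<open>hrep (B j)\<close>. Hence the left factors
  \<open>A\<^sub>1\<close>, \<open>A\<^sub>2\<close> are plain complex matrices.\<close>
lemma Psi_mult:
  assumes A: "A \<in> carrier_mat m n" and X: "X \<in> carrier_mat n s" and B: "B \<in> carrier_mat s t"
  shows "Psi (A * X * B) =
    map_mat cpart1 A * Psi X * hrep B + map_mat cpart2 A * Psi X * hrep (times_j B)"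
proof -
  define A1 A2 X1 X2 B1 B2 where parts: "A1 = map_mat cpart1 A" "A2 = map_mat cpart2 A"
    "X1 = map_mat cpart1 X" "X2 = map_mat cpart2 X" "B1 = map_mat cpart1 B" "B2 = map_mat cpart2 B"
  have c: "A1 \<in> carrier_mat m n" "A2 \<in> carrier_mat m n" "X1 \<in> carrier_mat n s" "X2 \<in> carrier_mat n s"
    "B1 \<in> carrier_mat s t" "B2 \<in> carrier_mat s t"
    using A X B by (auto simp: parts)
  have d: "dim_row A1 = m" "dim_col A1 = n" "dim_row A2 = m" "dim_col A2 = n" "dim_row X1 = n" "dim_col X1 = s"
    "dim_row X2 = n" "dim_col X2 = s" "dim_row B1 = s" "dim_col B1 = t" "dim_row B2 = s" "dim_col B2 = t"
    using c by auto
  have AX: "A1 * X1 \<in> carrier_mat m s" "A1 * X2 \<in> carrier_mat m s" "A2 * X1 \<in> carrier_mat m s" "A2 * X2 \<in> carrier_mat m s"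
    using c by auto
  have 1: "A1 * Psi X * hrep B = join_cols (A1 * X1 * B1 + A1 * X2 * B2) (A1 * X1 * B2 + A1 * X2 * B1)"
    using mult_join_cols[OF c(1,3,4)] join_cols_mult_four_block[OF AX(1,2) c(5,6,6,5)]
    by (simp add: Psi_eq hrep_def parts)
  have 2: "A2 * Psi X * hrep (times_j B) = join_cols (A2 * X1 * B2 + A2 * X2 * B1) (A2 * X1 * B1 + A2 * X2 * B2)"
    using mult_join_cols[OF c(2,3,4)] join_cols_mult_four_block[OF AX(3,4) c(6,5,5,6)]
    by (simp add: Psi_eq hrep_times_j parts)
  have "Psi (A * X * B) = join_cols
      ((A1 * X1 + A2 * X2) * B1 + (A1 * X2 + A2 * X1) * B2) ((A1 * X1 + A2 * X2) * B2 + (A1 * X2 + A2 * X1) * B1)"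
    using A X B by (simp add: Psi_eq map_mat_cpart_mult parts del: assoc_mult_mat)
  also have "\<dots> = join_cols (A1 * X1 * B1 + A1 * X2 * B2) (A1 * X1 * B2 + A1 * X2 * B1)
      + join_cols (A2 * X1 * B2 + A2 * X2 * B1) (A2 * X1 * B1 + A2 * X2 * B2)"
  proof -
    have "(A1 * X1 + A2 * X2) * Y + (A1 * X2 + A2 * X1) * Y' =
        (A1 * X1 * Y + A1 * X2 * Y') + (A2 * X1 * Y' + A2 * X2 * Y)"
      if "Y \<in> carrier_mat s t" "Y' \<in> carrier_mat s t" for Y Y'
      using d that carrier_matD[OF that(1)] carrier_matD[OF that(2)]
      by (simp add: add_mult_dims del: assoc_mult_mat) (intro eq_matI, simp_all del: index_mult_mat(1) assoc_mult_mat)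
    note e = this[OF c(5,6)] this[OF c(6,5)]
    have AXB: "A' * X' * B' \<in> carrier_mat m t"
      if "A' \<in> carrier_mat m n" "X' \<in> carrier_mat n s" "B' \<in> carrier_mat s t" for A' X' B' :: "complex mat"
      using that by (intro mult_carrier_mat)
    show ?thesis
      unfolding e by (rule add_join_cols[of _ m t _ t, symmetric]; intro add_carrier_mat AXB c)
  qed
  finally show ?thesis unfolding parts(1,2)[symmetric] 1 2 .
qed

lemma map_vec_append: "map_vec f (u @\<^sub>v v) = map_vec f u @\<^sub>v map_vec f v"
  by (intro eq_vecI) auto

lemma Wmat_mult_vec:
  assumes "u1 \<in> carrier_vec N" "u2 \<in> carrier_vec N" "u3 \<in> carrier_vec N" "u4 \<in> carrier_vec N"
  shows "Wmat N *\<^sub>v (u1 @\<^sub>v u2 @\<^sub>v u3 @\<^sub>v u4) = (u1 + \<i> \<cdot>\<^sub>v u2) @\<^sub>v (u3 + \<i> \<cdot>\<^sub>v u4)"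
proof -
  have one: "(\<i> \<cdot>\<^sub>m 1\<^sub>m N) *\<^sub>v u = \<i> \<cdot>\<^sub>v u" if "u \<in> carrier_vec N" for u
    using that by (intro eq_vecI) (auto simp: smult_scalar_prod_distrib[of _ N])
  have zero: "0\<^sub>m N N *\<^sub>v u = 0\<^sub>v N" if "u \<in> carrier_vec N" for u :: "complex vec"
    using that by (intro eq_vecI) auto
  have "block_row N [1\<^sub>m N, \<i> \<cdot>\<^sub>m 1\<^sub>m N, 0\<^sub>m N N, 0\<^sub>m N N] *\<^sub>v (u1 @\<^sub>v u2 @\<^sub>v u3 @\<^sub>v u4) = u1 + \<i> \<cdot>\<^sub>v u2"
    using assms by (simp add: join_cols_mult_vec[of _ N N _ "N + (N + N)"]
        join_cols_mult_vec[of _ N N _ "N + N"] join_cols_mult_vec[of _ N N _ N] one zero carrier_matI)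
  moreover have "block_row N [0\<^sub>m N N, 0\<^sub>m N N, 1\<^sub>m N, \<i> \<cdot>\<^sub>m 1\<^sub>m N] *\<^sub>v (u1 @\<^sub>v u2 @\<^sub>v u3 @\<^sub>v u4) = u3 + \<i> \<cdot>\<^sub>v u4"
    using assms by (simp add: join_cols_mult_vec[of _ N N _ "N + (N + N)"]
        join_cols_mult_vec[of _ N N _ "N + N"] join_cols_mult_vec[of _ N N _ N] one zero carrier_matI)
  moreover have "Wmat N *\<^sub>v (u1 @\<^sub>v u2 @\<^sub>v u3 @\<^sub>v u4) =
      block_row N [1\<^sub>m N, \<i> \<cdot>\<^sub>m 1\<^sub>m N, 0\<^sub>m N N, 0\<^sub>m N N] *\<^sub>v (u1 @\<^sub>v u2 @\<^sub>v u3 @\<^sub>v u4) @\<^sub>v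
      block_row N [0\<^sub>m N N, 0\<^sub>m N N, 1\<^sub>m N, \<i> \<cdot>\<^sub>m 1\<^sub>m N] *\<^sub>v (u1 @\<^sub>v u2 @\<^sub>v u3 @\<^sub>v u4)"
    unfolding Wmat_def using assms
    by (intro mat_mult_append[of _ N "N + (N + (N + N))" _ N]) (auto intro!: carrier_matI carrier_vecI)
  ultimately show ?thesis by simp
qed

lemma vec_mat_real_rep:
  "vec_mat (real_rep X) = vec_mat (map_mat (Re \<circ> cpart1) X) @\<^sub>v vec_mat (map_mat (Im \<circ> cpart1) X) @\<^sub>v
     vec_mat (map_mat (Re \<circ> cpart2) X) @\<^sub>v vec_mat (map_mat (Im \<circ> cpart2) X)"
  by (simp add: real_rep_def vec_mat_join_cols)

text \<open>\<open>W\<close> reassembles each complex entry from its real and imaginary parts.\<close>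
lemma Wmat_real_rep:
  assumes X: "X \<in> carrier_mat p q"
  shows "Wmat (p * q) *\<^sub>v map_vec complex_of_real (vec_mat (real_rep X)) = vec_mat (Psi X)"
proof -
  have c: "map_vec complex_of_real (vec_mat (map_mat f X)) \<in> carrier_vec (p * q)" for f
    using X by (intro carrier_vecI) simp
  have "map_vec complex_of_real (vec_mat (map_mat (Re \<circ> f) X)) + \<i> \<cdot>\<^sub>v map_vec complex_of_real (vec_mat (map_mat (Im \<circ> f) X))
    = vec_mat (map_mat f X)" for f
    by (intro eq_vecI) (auto simp: vec_mat_map complex_eq_iff)
  then show ?thesis
    by (simp add: vec_mat_real_rep map_vec_append Wmat_mult_vec[OF c c c c] Psi_eq vec_mat_join_cols)
qed

lemma vec_Psi_inj:
  assumes "X \<in> carrier_mat p q" "Y \<in> carrier_mat p q" "vec_mat (Psi X) = vec_mat (Psi Y)"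
  shows "X = Y"
proof -
  have eq: "Psi X = Psi Y" using assms by (intro vec_mat_eqI) (auto simp: Psi_eq)
  have "X $$ (i, j) = Y $$ (i, j)" if "i < p" "j < q" for i j
    using arg_cong[OF eq, of "\<lambda>A. A $$ (i, j)"] arg_cong[OF eq, of "\<lambda>A. A $$ (i, q + j)"] that assms(1,2)
    by (intro cpart_eqI) (auto simp: Psi_eq join_cols_index)
  then show ?thesis using assms by (intro eq_matI) auto
qed

lemma real_rep_inj:
  assumes "X \<in> carrier_mat p q" "Y \<in> carrier_mat p q" "vec_mat (real_rep X) = vec_mat (real_rep Y)"
  shows "X = Y"
  using vec_Psi_inj[OF assms(1,2)] Wmat_real_rep[OF assms(1)] Wmat_real_rep[OF assms(2)] assms(3) by simp

lemma Re_Im_mult_of_real: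
  assumes "y \<in> carrier_vec (dim_col S)"
  shows "map_mat Re S *\<^sub>v y = map_vec Re (S *\<^sub>v map_vec complex_of_real y)"
    and "map_mat Im S *\<^sub>v y = map_vec Im (S *\<^sub>v map_vec complex_of_real y)"
  using assms by (auto intro!: eq_vecI sum.cong simp: scalar_prod_def)

lemma of_real_mult_mat_vec:
  assumes "y \<in> carrier_vec (dim_col M)"
  shows "map_mat complex_of_real M *\<^sub>v map_vec complex_of_real y = map_vec complex_of_real (M *\<^sub>v y)"
  using assms by (auto intro!: eq_vecI sum.cong simp: scalar_prod_def)

lemma coordinate_matrix_carrier:
  assumes "A \<in> carrier_mat m n" "B \<in> carrier_mat s t" "M \<in> carrier_mat N c"
  shows "((hrep B)\<^sup>T \<otimes>\<^sub>K map_mat cpart1 A + (hrep (times_j B))\<^sup>T \<otimes>\<^sub>K map_mat cpart2 A)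
           * W * map_mat complex_of_real M \<in> carrier_mat (2 * m * t) c"
  using assms by (intro carrier_matI) (auto simp: kronecker_def hrep_def times_j_def)

text \<open>\<open>\<Psi> (A X B)\<close> is a sum of products with \<open>\<Psi> X\<close> in the middle, so its vectorization is
  a Kronecker matrix applied to \<open>vec (\<Psi> X) = W (M y)\<close>, where \<open>y\<close> is the coordinate vector of \<open>X\<close>.\<close>
lemma vec_Psi_mult_coordinates:
  assumes A: "A \<in> carrier_mat m n" and X: "X \<in> carrier_mat n s" and B: "B \<in> carrier_mat s t"
    and M: "M \<in> carrier_mat (4 * n * s) c" and y: "y \<in> carrier_vec c"
    and S: "S = ((hrep B)\<^sup>T \<otimes>\<^sub>K map_mat cpart1 A + (hrep (times_j B))\<^sup>T \<otimes>\<^sub>K map_mat cpart2 A)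
                 * Wmat (n * s) * map_mat complex_of_real M"
    and Xy: "vec_mat (real_rep X) = M *\<^sub>v y"
  shows "vec_mat (Psi (A * X * B)) = S *\<^sub>v map_vec complex_of_real y"
proof -
  have hB: "hrep B \<in> carrier_mat (2 * s) (2 * t)" and hjB: "hrep (times_j B) \<in> carrier_mat (2 * s) (2 * t)"
    using B by (auto simp: hrep_def times_j_def intro!: carrier_matI)
  have PX: "Psi X \<in> carrier_mat n (2 * s)" using X by (auto simp: Psi_eq intro!: carrier_matI)
  have A12: "map_mat cpart1 A \<in> carrier_mat m n" "map_mat cpart2 A \<in> carrier_mat m n" using A by auto
  let ?K1 = "(hrep B)\<^sup>T \<otimes>\<^sub>K map_mat cpart1 A" and ?K2 = "(hrep (times_j B))\<^sup>T \<otimes>\<^sub>K map_mat cpart2 A"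
  let ?W = "Wmat (n * s)" and ?M = "map_mat complex_of_real M"
  have K: "?K1 \<in> carrier_mat (2 * m * t) (2 * n * s)" "?K2 \<in> carrier_mat (2 * m * t) (2 * n * s)"
    using hB hjB A by (auto simp: kronecker_def intro!: carrier_matI)
  have K12: "?K1 + ?K2 \<in> carrier_mat (2 * m * t) (2 * n * s)" by (rule add_carrier_mat[OF K(2)])
  have W: "?W \<in> carrier_mat (2 * n * s) (4 * n * s)" by (auto simp: Wmat_def intro!: carrier_matI)
  have M': "?M \<in> carrier_mat (4 * n * s) c" using M by auto
  have KW: "(?K1 + ?K2) * ?W \<in> carrier_mat (2 * m * t) (4 * n * s)" by (rule mult_carrier_mat[OF K12 W])
  let ?y = "map_vec complex_of_real y" and ?x = "map_vec complex_of_real (vec_mat (real_rep X))"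
  have y': "?y \<in> carrier_vec c" using y by auto
  have x: "?x \<in> carrier_vec (4 * n * s)" using M y by (simp add: Xy)
  have "S *\<^sub>v ?y = (?K1 + ?K2) * ?W *\<^sub>v (?M *\<^sub>v ?y)"
    unfolding S by (rule assoc_mult_mat_vec[OF KW M' y'])
  also have "?M *\<^sub>v ?y = ?x"
    using M y by (simp add: Xy of_real_mult_mat_vec)
  also have "(?K1 + ?K2) * ?W *\<^sub>v ?x = (?K1 + ?K2) *\<^sub>v (?W *\<^sub>v ?x)"
    by (rule assoc_mult_mat_vec[OF K12 W x])
  also have "?W *\<^sub>v ?x = vec_mat (Psi X)" by (rule Wmat_real_rep[OF X])
  also have "(?K1 + ?K2) *\<^sub>v vec_mat (Psi X) = ?K1 *\<^sub>v vec_mat (Psi X) + ?K2 *\<^sub>v vec_mat (Psi X)"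
    using PX by (intro add_mult_distrib_mat_vec[OF K]) (auto intro!: carrier_vecI)
  also have "\<dots> = vec_mat (map_mat cpart1 A * Psi X * hrep B) + vec_mat (map_mat cpart2 A * Psi X * hrep (times_j B))"
    by (simp only: kronecker_mult_vec_mat[OF A12(1) PX hB] kronecker_mult_vec_mat[OF A12(2) PX hjB])
  also have "\<dots> = vec_mat (Psi (A * X * B))"
  proof -
    have "map_mat cpart1 A * Psi X * hrep B \<in> carrier_mat m (2 * t)"
      by (rule mult_carrier_mat[OF mult_carrier_mat[OF A12(1) PX] hB])
    moreover have "map_mat cpart2 A * Psi X * hrep (times_j B) \<in> carrier_mat m (2 * t)"
      by (rule mult_carrier_mat[OF mult_carrier_mat[OF A12(2) PX] hjB])
    ultimately show ?thesis by (simp only: Psi_mult[OF A X B] vec_mat_add)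
  qed
  finally show "vec_mat (Psi (A * X * B)) = S *\<^sub>v ?y" by simp
qed

section \<open>Block matrices acting on stacked vectors\<close>

lemma stack_vecs_map_eq_iff:
  assumes "\<And>l. l \<in> set ls \<Longrightarrow> dim_vec (f l) = dim_vec (g l)"
  shows "stack_vecs (map f ls) = stack_vecs (map g ls) \<longleftrightarrow> (\<forall>l\<in>set ls. f l = g l)"
  using assms
proof (induction ls)
  case (Cons l ls)
  have "f l \<in> carrier_vec (dim_vec (f l))" "g l \<in> carrier_vec (dim_vec (f l))"
    using Cons.prems[of l] by (auto intro: carrier_vecI)
  from append_vec_eq[OF this] Cons.IH[OF Cons.prems] show ?case by simp
qed simp

lemma stack_vecs_carrier:
  assumes "\<And>l. l \<in> set ls \<Longrightarrow> f l \<in> carrier_vec (c l)"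
  shows "stack_vecs (map f ls) \<in> carrier_vec (\<Sum>l\<leftarrow>ls. c l)"
  using assms by (intro carrier_vecI) (auto simp: dim_stack_vecs o_def intro!: arg_cong[of _ _ sum_list])

lemma carrier_vec_stack_vecs:
  assumes "distinct ls" "y \<in> carrier_vec (\<Sum>l\<leftarrow>ls. c l)"
  obtains f where "\<And>l. l \<in> set ls \<Longrightarrow> f l \<in> carrier_vec (c l)" "y = stack_vecs (map f ls)"
proof -
  have "\<exists>f. (\<forall>l\<in>set ls. f l \<in> carrier_vec (c l)) \<and> y = stack_vecs (map f ls)"
    using assms
  proof (induction ls arbitrary: y)
    case (Cons l ls)
    let ?m = "\<Sum>l\<leftarrow>ls. c l"
    have y: "y = vec_first y (c l) @\<^sub>v vec_last y ?m" using Cons.prems by simp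
    obtain f where f: "\<forall>l\<in>set ls. f l \<in> carrier_vec (c l)" "vec_last y ?m = stack_vecs (map f ls)"
      using Cons.IH[of "vec_last y ?m"] Cons.prems by auto
    let ?f = "f(l := vec_first y (c l))"
    have "map ?f ls = map f ls" using Cons.prems by auto
    then have e: "stack_vecs (map ?f ls) = stack_vecs (map f ls)" by (rule arg_cong)
    have "stack_vecs (map ?f (l # ls)) = vec_first y (c l) @\<^sub>v stack_vecs (map ?f ls)" by simp
    also have "\<dots> = y" by (simp only: e f(2)[symmetric] y[symmetric])
    finally have "y = stack_vecs (map ?f (l # ls))" by (rule sym)
    moreover have "\<forall>i\<in>set (l # ls). ?f i \<in> carrier_vec (c i)" using f(1) by auto
    ultimately show ?case by blast
  qed auto
  then show ?thesis using that by blast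
qed

lemma block_row_carrier:
  assumes "\<And>l. l \<in> set ls \<Longrightarrow> F l \<in> carrier_mat nr (c l)"
  shows "block_row nr (map F ls) \<in> carrier_mat nr (\<Sum>l\<leftarrow>ls. c l)"
  using assms
proof (induction ls)
  case (Cons l ls)
  then have "F l \<in> carrier_mat nr (c l)" "block_row nr (map F ls) \<in> carrier_mat nr (\<Sum>l\<leftarrow>ls. c l)"
    by auto
  then show ?case by (intro carrier_matI) auto
qed simp

lemma index_block_row_mult_stack_vecs:
  fixes F :: "'b \<Rightarrow> 'a :: semiring_0 mat"
  assumes "\<And>l. l \<in> set ls \<Longrightarrow> F l \<in> carrier_mat nr (c l)" "\<And>l. l \<in> set ls \<Longrightarrow> y l \<in> carrier_vec (c l)" "k < nr"
  shows "(block_row nr (map F ls) *\<^sub>v stack_vecs (map y ls)) $ k = (\<Sum>l\<leftarrow>ls. (F l *\<^sub>v y l) $ k)"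
  using assms
proof (induction ls)
  case (Cons l ls)
  have l: "F l \<in> carrier_mat nr (c l)" "y l \<in> carrier_vec (c l)"
    and ls: "block_row nr (map F ls) \<in> carrier_mat nr (\<Sum>l\<leftarrow>ls. c l)"
      "stack_vecs (map y ls) \<in> carrier_vec (\<Sum>l\<leftarrow>ls. c l)"
    and IH: "(block_row nr (map F ls) *\<^sub>v stack_vecs (map y ls)) $ k = (\<Sum>l\<leftarrow>ls. (F l *\<^sub>v y l) $ k)"
    using Cons by (auto intro!: block_row_carrier stack_vecs_carrier)
  have "block_row nr (map F (l # ls)) *\<^sub>v stack_vecs (map y (l # ls)) =
      F l *\<^sub>v y l + block_row nr (map F ls) *\<^sub>v stack_vecs (map y ls)"
    using join_cols_mult_vec[OF l(1) ls(1) l(2) ls(2)] by simp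
  moreover have "k < dim_vec (block_row nr (map F ls) *\<^sub>v stack_vecs (map y ls))"
    using ls \<open>k < nr\<close> by simp
  ultimately show ?case by (simp only: index_add_vec IH list.map sum_list.Cons)
qed (simp add: scalar_prod_def)

lemma diag_block_mat_mult_stack_vecs:
  fixes F :: "'b \<Rightarrow> 'a :: semiring_0 mat"
  assumes "\<And>l. l \<in> set ls \<Longrightarrow> y l \<in> carrier_vec (dim_col (F l))"
  shows "diag_block_mat (map F ls) *\<^sub>v stack_vecs (map y ls) = stack_vecs (map (\<lambda>l. F l *\<^sub>v y l) ls)"
  using assms
proof (induction ls)
  case (Cons l ls)
  let ?D = "diag_block_mat (map F ls)" and ?y = "stack_vecs (map y ls)"
  have y: "?y \<in> carrier_vec (dim_col ?D)"
    using stack_vecs_carrier[of ls y "\<lambda>l. dim_col (F l)"] Cons.prems by (simp add: dim_diag_block_mat o_def)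
  have "diag_block_mat (map F (l # ls)) *\<^sub>v stack_vecs (map y (l # ls)) =
      (F l *\<^sub>v y l + 0\<^sub>m (dim_row (F l)) (dim_col ?D) *\<^sub>v ?y) @\<^sub>v (0\<^sub>m (dim_row ?D) (dim_col (F l)) *\<^sub>v y l + ?D *\<^sub>v ?y)"
    using Cons.prems y
    by (simp add: Let_def) (rule four_block_mat_mult_vec[where ?nr1.0 = "dim_row (F l)" and ?nc2.0 = "dim_col ?D"], auto intro!: carrier_matI)
  also have "\<dots> = (F l *\<^sub>v y l) @\<^sub>v (?D *\<^sub>v ?y)"
    using Cons.prems y by (intro arg_cong2[of _ _ _ _ append_vec] eq_vecI) auto
  finally show ?case using Cons by simp
qed (auto intro!: eq_vecI)

lemma index_finsum_mat:
  fixes F :: "'b \<Rightarrow> 'a :: comm_ring_1 mat"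
  assumes "finite I" "\<And>l. l \<in> I \<Longrightarrow> F l \<in> carrier_mat m t"
  shows "finsum (module_mat TYPE('a) m t) F I \<in> carrier_mat m t"
    and "i < m \<Longrightarrow> j < t \<Longrightarrow> finsum (module_mat TYPE('a) m t) F I $$ (i, j) = (\<Sum>l\<in>I. F l $$ (i, j))"
proof -
  interpret abelian_group "module_mat TYPE('a) m t" by (rule abelian_group_mat)
  have c: "finsum (module_mat TYPE('a) m t) F J \<in> carrier_mat m t" if "J \<subseteq> I" for J
    using finsum_closed[of F J] assms that by (auto simp: module_mat_simps)
  then show "finsum (module_mat TYPE('a) m t) F I \<in> carrier_mat m t" by blast
  show "finsum (module_mat TYPE('a) m t) F I $$ (i, j) = (\<Sum>l\<in>I. F l $$ (i, j))" if "i < m" "j < t"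
    using assms(1) assms(2) c
  proof (induction I)
    case empty
    then show ?case using that by (simp add: module_mat_simps)
  next
    case (insert l I)
    have "finsum (module_mat TYPE('a) m t) F (insert l I) = F l + finsum (module_mat TYPE('a) m t) F I"
      using insert by (subst finsum_insert) (auto simp: module_mat_simps)
    moreover have "finsum (module_mat TYPE('a) m t) F I \<in> carrier_mat m t"
      using insert.prems(2) by blast
    moreover have "finsum (module_mat TYPE('a) m t) F I $$ (i, j) = (\<Sum>l\<in>I. F l $$ (i, j))"
      by (rule insert.IH) (use insert.prems in blast)+
    ultimately show ?case using insert.hyps that by simp
  qed
qed

section \<open>Coordinates in an L-structure\<close>

text \<open>The columns of \<open>M\<close> are a basis of \<open>G\<close> as a space of its own. Span and independence are the same
  in the ambient space, where linear combinations of the columns are products \<open>M y\<close>.\<close>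
lemma basis_matrix_bij_betw:
  assumes G: "submodule class_ring G (module_vec TYPE(real) N)" and B: "basis_matrix N G M"
  shows "bij_betw ((*\<^sub>v) M) (carrier_vec (dim_col M)) G"
proof -
  interpret vec_space "TYPE(real)" N .
  let ?S = "set (cols M)"
  have M: "M \<in> carrier_mat N (dim_col M)" and dist: "distinct (cols M)"
    and bas: "vectorspace.basis class_ring (V\<lparr>carrier := G\<rparr>) ?S"
    using B by (auto simp: basis_matrix_def)
  have vs: "vectorspace class_ring (V\<lparr>carrier := G\<rparr>)"
    using G vec_vs by (intro subspace_is_vs) (simp add: subspace_def)
  have row: "dim_row M = N" using B by (simp add: basis_matrix_def)
  note bas = bas[unfolded vectorspace.basis_def[OF vs]]
  have SG: "?S \<subseteq> G" using bas by simp
  have ind: "lin_indpt ?S" and span: "span ?S = G"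
    using bas span_li_not_depend[OF SG G] by auto
  have SV: "?S \<subseteq> carrier_vec N" using row cols_dim[of M] by simp
  have "M *\<^sub>v y \<in> G" if "y \<in> carrier_vec (dim_col M)" for y
    using lincomb_eq_mat_mult[OF M that dist] span by (metis List.finite_set in_spanI subset_refl)
  moreover have "\<exists>y\<in>carrier_vec (dim_col M). g = M *\<^sub>v y" if "g \<in> G" for g
  proof -
    have "g \<in> span ?S" using that by (simp only: span)
    then obtain a where "lincomb a ?S = g" using finite_in_span[OF finite_set SV] by blast
    then show ?thesis using mat_mult_eq_lincomb[OF M dist, of a] by (metis vec_carrier)
  qed
  moreover have "y = z" if yz: "y \<in> carrier_vec (dim_col M)" "z \<in> carrier_vec (dim_col M)" and eq: "M *\<^sub>v y = M *\<^sub>v z" for y z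
  proof -
    have "M *\<^sub>v (y - z) = M *\<^sub>v y - M *\<^sub>v z" using yz by (rule mult_minus_distrib_mat_vec[OF M])
    also have "\<dots> = 0\<^sub>v N" by (intro eq_vecI) (simp_all add: eq row)
    finally have z: "M *\<^sub>v (y - z) = 0\<^sub>v N" .
    have c: "y - z \<in> carrier_vec (dim_col M)" by (rule minus_carrier_vec[OF yz])
    have "y - z = 0\<^sub>v (dim_col M)"
      by (rule ccontr) (rule notE[OF ind lin_depI[OF M c _ z dist]])
    then have "(y - z) $ i = 0" if "i < dim_col M" for i using that by simp
    then show ?thesis using yz by (intro eq_vecI) auto
  qed
  ultimately show ?thesis by (auto simp: bij_betw_def inj_on_def image_iff)
qed

lemma vec_mat_zero: "vec_mat (0\<^sub>m p q) = 0\<^sub>v (p * q)"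
proof (intro eq_vecI)
  fix k assume "k < dim_vec (0\<^sub>v (p * q) :: 'a vec)"
  then have k: "k < p * q" by simp
  then have "p > 0" by (cases p) auto
  then have "k mod p < p" "k div p < q" using k by (auto simp: less_mult_imp_div_less mult.commute)
  then show "vec_mat (0\<^sub>m p q) $ k = (0\<^sub>v (p * q) :: 'a vec) $ k"
    using k by (simp add: index_vec_mat')
qed simp

lemma L_struct_submodule:
  assumes "real_subspace (p * q) \<Omega>"
  shows "submodule class_ring ((\<lambda>X. vec_mat (real_rep X)) ` L_struct p q \<Omega>) (module_vec TYPE(real) (4 * p * q))"
proof -
  interpret vec_space "TYPE(real)" "4 * p * q" .
  let ?g = "\<lambda>X. vec_mat (real_rep X)"
  have \<Omega>: "0\<^sub>v (p * q) \<in> \<Omega>" "\<And>u v. u \<in> \<Omega> \<Longrightarrow> v \<in> \<Omega> \<Longrightarrow> u + v \<in> \<Omega>" "\<And>c v. v \<in> \<Omega> \<Longrightarrow> map_vec ((*\<^sub>R) c) v \<in> \<Omega>"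
    using assms by (auto simp: real_subspace_def)
  have dim: "?g X \<in> carrier_vec (4 * p * q)" if "X \<in> carrier_mat p q" for X
    using that by (intro carrier_vecI) (simp add: vec_mat_real_rep)
  have add: "?g (X + Y) = ?g X + ?g Y" if "X \<in> carrier_mat p q" "Y \<in> carrier_mat p q" for X Y
  proof -
    have "vec_mat (map_mat f (X + Y)) = vec_mat (map_mat f X) + vec_mat (map_mat f Y)"
      if "\<And>x y. f (x + y) = f x + f y" for f :: "rbq \<Rightarrow> real"
    proof -
      have "map_mat f (X + Y) = map_mat f X + map_mat f Y"
        using \<open>X \<in> carrier_mat p q\<close> \<open>Y \<in> carrier_mat p q\<close> by (intro eq_matI) (auto simp: that)
      then show ?thesis
        using vec_mat_add[of "map_mat f X" p q "map_mat f Y"] \<open>X \<in> carrier_mat p q\<close> \<open>Y \<in> carrier_mat p q\<close> by simp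
    qed
    then show ?thesis using that
      by (simp add: vec_mat_real_rep append_vec_add[of _ "p * q" _ _ "p * q + (p * q + p * q)"]
          append_vec_add[of _ "p * q" _ _ "p * q + p * q"] append_vec_add[of _ "p * q" _ _ "p * q"] carrier_vecI)
  qed
  have smult: "?g (map_mat ((*\<^sub>R) c) X) = c \<cdot>\<^sub>v ?g X" for c X
    by (intro eq_vecI) (auto simp: vec_mat_real_rep vec_mat_map cpart1_def cpart2_def scaleR_rbq_def)
  have zero: "?g (0\<^sub>m p q) = 0\<^sub>v (4 * p * q)"
    by (intro eq_vecI) (auto simp: vec_mat_real_rep vec_mat_map vec_mat_zero)
  have "0\<^sub>m p q \<in> L_struct p q \<Omega>"
    using \<Omega> by (simp add: L_struct_def vec_mat_zero)
  then have "0\<^sub>v (4 * p * q) \<in> ?g ` L_struct p q \<Omega>" using zero by (metis imageI)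
  moreover have "?g X + ?g Y \<in> ?g ` L_struct p q \<Omega>" if "X \<in> L_struct p q \<Omega>" "Y \<in> L_struct p q \<Omega>" for X Y
  proof -
    have "X + Y \<in> L_struct p q \<Omega>" using that vec_mat_add[of X p q Y] \<Omega>(2) by (auto simp: L_struct_def)
    moreover have "?g (X + Y) = ?g X + ?g Y" using that by (intro add) (auto simp: L_struct_def)
    ultimately show ?thesis by (metis imageI)
  qed
  moreover have "c \<cdot>\<^sub>v ?g X \<in> ?g ` L_struct p q \<Omega>" if "X \<in> L_struct p q \<Omega>" for c X
  proof -
    have "map_mat ((*\<^sub>R) c) X \<in> L_struct p q \<Omega>" using that \<Omega>(3) by (auto simp: L_struct_def vec_mat_map)
    then show ?thesis using smult[of c X] by (metis imageI)
  qed
  ultimately show ?thesis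
    using module_axioms dim unfolding submodule_def
    by (auto simp: L_struct_def module_vec_simps)
qed

lemma L_basis_matrix_bij_betw:
  assumes "real_subspace (p * q) \<Omega>" "L_basis_matrix p q \<Omega> M"
  shows "bij_betw ((*\<^sub>v) M) (carrier_vec (dim_col M)) ((\<lambda>X. vec_mat (real_rep X)) ` L_struct p q \<Omega>)"
  using assms basis_matrix_bij_betw L_struct_submodule unfolding L_basis_matrix_def by blast

section \<open>The matrix equation in coordinates\<close>

lemma index_vec_Psi_finsum:
  assumes "finite I" "\<And>l. l \<in> I \<Longrightarrow> F l \<in> carrier_mat m t" "k < 2 * m * t"
  shows "vec_mat (Psi (finsum (module_mat TYPE(rbq) m t) F I)) $ k = (\<Sum>l\<in>I. vec_mat (Psi (F l)) $ k)"
proof -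
  let ?S = "finsum (module_mat TYPE(rbq) m t) F I"
  have S: "?S \<in> carrier_mat m t" by (rule index_finsum_mat(1)[OF assms(1,2)])
  have "m > 0" using assms(3) by (cases m) auto
  then have k: "k mod m < m" "k div m < t + t"
    using assms(3) less_mult_imp_div_less[of k "2 * t" m] by (auto simp: mult_ac)
  have ix: "vec_mat (Psi X) $ k =
      (if k div m < t then cpart1 (X $$ (k mod m, k div m)) else cpart2 (X $$ (k mod m, k div m - t)))"
    if "X \<in> carrier_mat m t" for X
    using that k assms(3) by (subst index_vec_mat') (auto simp: Psi_eq join_cols_index algebra_simps)
  have "vec_mat (Psi ?S) $ k =
      (\<Sum>l\<in>I. if k div m < t then cpart1 (F l $$ (k mod m, k div m)) else cpart2 (F l $$ (k mod m, k div m - t)))"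
    using k by (subst ix[OF S]) (auto simp: index_finsum_mat(2)[OF assms(1,2)] cpart_sum)
  also have "\<dots> = (\<Sum>l\<in>I. vec_mat (Psi (F l)) $ k)"
    by (intro sum.cong refl ix[symmetric] assms(2))
  finally show ?thesis .
qed

lemma complex_vec_eq_iff: "v = w \<longleftrightarrow> map_vec Re v = map_vec Re w \<and> map_vec Im v = map_vec Im w"
proof
  assume eq: "map_vec Re v = map_vec Re w \<and> map_vec Im v = map_vec Im w"
  then have "dim_vec v = dim_vec w" by (metis index_map_vec(2))
  moreover have "v $ i = w $ i" if "i < dim_vec w" for i
    using eq that \<open>dim_vec v = dim_vec w\<close> by (metis complex_eq_iff index_map_vec(1))
  ultimately show "v = w" by (intro eq_vecI)
qed simp

text \<open>\<open>\<Psi>\<close> is additive and injective, so the matrix equation is equivalent to the complex linear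
  system \<open>\<Sum>\<^sub>l S\<^sub>l f\<^sub>l = vec (\<Psi> E)\<close>. The coordinates \<open>f\<^sub>l\<close> are real, so its real and imaginary parts
  separate into one system for \<open>Q1\<close> and one for \<open>Q2\<close>.\<close>
lemma system_in_coordinates:
  assumes A: "\<And>l. l \<in> {1..r} \<Longrightarrow> A l \<in> carrier_mat m (n l)"
    and B: "\<And>l. l \<in> {1..r} \<Longrightarrow> B l \<in> carrier_mat (s l) t"
    and E: "E \<in> carrier_mat m t"
    and X: "\<And>l. l \<in> {1..r} \<Longrightarrow> X l \<in> carrier_mat (n l) (s l)"
    and M: "\<And>l. l \<in> {1..r} \<Longrightarrow> M l \<in> carrier_mat (4 * n l * s l) (c l)"
    and f: "\<And>l. l \<in> {1..r} \<Longrightarrow> f l \<in> carrier_vec (c l)"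
    and Xf: "\<And>l. l \<in> {1..r} \<Longrightarrow> vec_mat (real_rep (X l)) = M l *\<^sub>v f l"
    and S: "\<And>l. l \<in> {1..r} \<Longrightarrow>
           S l = ((hrep (B l))\<^sup>T \<otimes>\<^sub>K map_mat cpart1 (A l)
                  + (hrep (times_j (B l)))\<^sup>T \<otimes>\<^sub>K map_mat cpart2 (A l))
                 * Wmat (n l * s l) * map_mat complex_of_real (M l)"
  shows "(\<Oplus>\<^bsub>module_mat TYPE(rbq) m t\<^esub>l\<in>{1..r}. A l * X l * B l) = E \<longleftrightarrow>
    (block_row (2 * m * t) (map (\<lambda>l. map_mat Re (S l)) [1..<Suc r])
      @\<^sub>r block_row (2 * m * t) (map (\<lambda>l. map_mat Im (S l)) [1..<Suc r])) *\<^sub>v stack_vecs (map f [1..<Suc r])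
    = vec_mat (map_mat Re (Psi E)) @\<^sub>v vec_mat (map_mat Im (Psi E))"
proof -
  let ?ls = "[1..<Suc r]" and ?y = "stack_vecs (map f [1..<Suc r])"
  let ?d = "\<Sum>l\<leftarrow>[1..<Suc r]. c l"
  let ?F = "\<lambda>l. A l * X l * B l"
  let ?sum = "\<Oplus>\<^bsub>module_mat TYPE(rbq) m t\<^esub>l\<in>{1..r}. ?F l"
  let ?Q = "\<lambda>g. block_row (2 * m * t) (map (\<lambda>l. map_mat g (S l)) ?ls) :: real mat"
  have ls: "l \<in> set ?ls \<longleftrightarrow> l \<in> {1..r}" for l by auto
  have Sc: "S l \<in> carrier_mat (2 * m * t) (c l)" if "l \<in> {1..r}" for l
    unfolding S[OF that] by (rule coordinate_matrix_carrier[OF A[OF that] B[OF that] M[OF that]])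
  have F: "?F l \<in> carrier_mat m t" if "l \<in> {1..r}" for l
    by (rule mult_carrier_mat[OF mult_carrier_mat[OF A[OF that] X[OF that]] B[OF that]])
  have sum: "?sum \<in> carrier_mat m t" by (rule index_finsum_mat(1)) (auto intro: F)
  have Qc: "?Q g \<in> carrier_mat (2 * m * t) ?d" for g
    using Sc by (intro block_row_carrier) auto
  have y: "?y \<in> carrier_vec ?d" using f by (intro stack_vecs_carrier) auto
  have Q: "?Q g *\<^sub>v ?y = map_vec g (vec_mat (Psi ?sum))"
    if g: "\<And>l. l \<in> {1..r} \<Longrightarrow> map_mat g (S l) *\<^sub>v f l = map_vec g (S l *\<^sub>v map_vec complex_of_real (f l))"
      and g_sum: "\<And>h. g (\<Sum>l\<in>{1..r}. h l) = (\<Sum>l\<in>{1..r}. g (h l))" for g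
  proof (intro eq_vecI)
    show dim: "dim_vec (?Q g *\<^sub>v ?y) = dim_vec (map_vec g (vec_mat (Psi ?sum)))"
      using Qc[of g] sum by (simp add: Psi_eq)
    fix k assume "k < dim_vec (map_vec g (vec_mat (Psi ?sum)))"
    then have k: "k < 2 * m * t" using sum by (simp add: Psi_eq algebra_simps)
    have "(?Q g *\<^sub>v ?y) $ k = (\<Sum>l\<leftarrow>?ls. (map_mat g (S l) *\<^sub>v f l) $ k)"
      using Sc f k by (intro index_block_row_mult_stack_vecs[of _ _ _ c]) auto
    also have "\<dots> = (\<Sum>l\<in>{1..r}. (map_mat g (S l) *\<^sub>v f l) $ k)"
      by (subst sum.distinct_set_conv_list[symmetric]) (auto intro!: sum.cong)
    also have "\<dots> = (\<Sum>l\<in>{1..r}. g (vec_mat (Psi (?F l)) $ k))"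
    proof (intro sum.cong refl)
      fix l assume l: "l \<in> {1..r}"
      have "vec_mat (Psi (?F l)) = S l *\<^sub>v map_vec complex_of_real (f l)"
        by (rule vec_Psi_mult_coordinates[OF A[OF l] X[OF l] B[OF l] M[OF l] f[OF l] S[OF l] Xf[OF l]])
      then show "(map_mat g (S l) *\<^sub>v f l) $ k = g (vec_mat (Psi (?F l)) $ k)"
        using k Sc[OF l] by (simp add: g[OF l] del: index_mult_mat_vec)
    qed
    also have "\<dots> = g (vec_mat (Psi ?sum) $ k)"
      by (simp only: index_vec_Psi_finsum[OF finite_atLeastAtMost F k] g_sum)
    also have "\<dots> = map_vec g (vec_mat (Psi ?sum)) $ k"
      using k sum by (simp add: Psi_eq algebra_simps)
    finally show "(?Q g *\<^sub>v ?y) $ k = map_vec g (vec_mat (Psi ?sum)) $ k" .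
  qed
  have fS: "f l \<in> carrier_vec (dim_col (S l))" if "l \<in> {1..r}" for l
    using f[OF that] by (simp only: carrier_matD(2)[OF Sc[OF that]])
  have QRe: "?Q Re *\<^sub>v ?y = map_vec Re (vec_mat (Psi ?sum))"
    by (rule Q[OF Re_Im_mult_of_real(1)[OF fS] Re_sum])
  have QIm: "?Q Im *\<^sub>v ?y = map_vec Im (vec_mat (Psi ?sum))"
    by (rule Q[OF Re_Im_mult_of_real(2)[OF fS] Im_sum])
  have dims: "map_vec Re (vec_mat (Psi ?sum)) \<in> carrier_vec (2 * m * t)"
    "map_vec Re (vec_mat (Psi E)) \<in> carrier_vec (2 * m * t)"
    using sum E by (auto simp: Psi_eq algebra_simps intro!: carrier_vecI)
  have "?sum = E \<longleftrightarrow> vec_mat (Psi ?sum) = vec_mat (Psi E)"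
    using vec_Psi_inj[OF sum E] by auto
  also have "\<dots> \<longleftrightarrow> map_vec Re (vec_mat (Psi ?sum)) @\<^sub>v map_vec Im (vec_mat (Psi ?sum)) =
      map_vec Re (vec_mat (Psi E)) @\<^sub>v map_vec Im (vec_mat (Psi E))"
    by (simp only: append_vec_eq[OF dims] complex_vec_eq_iff[of "vec_mat (Psi ?sum)"])
  finally show ?thesis
    by (simp only: mat_mult_append[OF Qc Qc y] QRe QIm vec_mat_map)
qed

text \<open>The solutions correspond one to one to the real solutions \<open>y\<close> of \<open>[Q1; Q2] y = e\<close>: an
  element of the L-structure determines and is determined by its coordinates, and the block diagonal
  matrix \<open>T\<close> turns stacked coordinates into the stacked real representations.\<close>
lemma L_solutions_bij_betw:
  assumes A: "\<And>l. l \<in> {1..r} \<Longrightarrow> A l \<in> carrier_mat m (n l)"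
    and B: "\<And>l. l \<in> {1..r} \<Longrightarrow> B l \<in> carrier_mat (s l) t"
    and E: "E \<in> carrier_mat m t"
    and \<Omega>: "\<And>l. l \<in> {1..r} \<Longrightarrow> real_subspace (n l * s l) (\<Omega> l)"
    and M: "\<And>l. l \<in> {1..r} \<Longrightarrow> L_basis_matrix (n l) (s l) (\<Omega> l) (M l)"
    and S: "\<And>l. l \<in> {1..r} \<Longrightarrow>
           S l = ((hrep (B l))\<^sup>T \<otimes>\<^sub>K map_mat cpart1 (A l)
                  + (hrep (times_j (B l)))\<^sup>T \<otimes>\<^sub>K map_mat cpart2 (A l))
                 * Wmat (n l * s l) * map_mat complex_of_real (M l)"
    and d: "d = (\<Sum>l = 1..r. dim_col (M l))"
    and Q1: "Q1 = block_row (2 * m * t) (map (\<lambda>l. map_mat Re (S l)) [1..<Suc r])"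
    and Q2: "Q2 = block_row (2 * m * t) (map (\<lambda>l. map_mat Im (S l)) [1..<Suc r])"
    and e: "e = vec_mat (map_mat Re (Psi E)) @\<^sub>v vec_mat (map_mat Im (Psi E))"
    and T: "T = diag_block_mat (map M [1..<Suc r])"
  shows "Q1 \<in> carrier_mat (2 * m * t) d" and "Q2 \<in> carrier_mat (2 * m * t) d"
    and "inj_on ((*\<^sub>v) T) (carrier_vec d)"
    and "bij_betw (stacked_rep r) (L_solutions r m t n s \<Omega> A B E)
      ((*\<^sub>v) T ` {y \<in> carrier_vec d. (Q1 @\<^sub>r Q2) *\<^sub>v y = e})"
proof -
  let ?ls = "[1..<Suc r]" and ?c = "\<lambda>l. dim_col (M l)"
  let ?g = "\<lambda>X. vec_mat (real_rep X)"
  let ?Sol = "L_solutions r m t n s \<Omega> A B E" and ?Y = "{y \<in> carrier_vec d. (Q1 @\<^sub>r Q2) *\<^sub>v y = e}"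
  have ls: "l \<in> set ?ls \<longleftrightarrow> l \<in> {1..r}" for l by auto
  have d': "d = (\<Sum>l\<leftarrow>?ls. ?c l)"
    unfolding d by (subst sum.distinct_set_conv_list[symmetric]) (auto intro!: sum.cong)
  have Mc: "M l \<in> carrier_mat (4 * n l * s l) (?c l)" if "l \<in> {1..r}" for l
    using M[OF that] by (intro carrier_matI) (simp_all add: L_basis_matrix_def basis_matrix_def)
  have bij: "bij_betw ((*\<^sub>v) (M l)) (carrier_vec (?c l)) (?g ` L_struct (n l) (s l) (\<Omega> l))"
    if "l \<in> {1..r}" for l
    by (rule L_basis_matrix_bij_betw[OF \<Omega>[OF that] M[OF that]])
  have Sc: "S l \<in> carrier_mat (2 * m * t) (?c l)" if "l \<in> {1..r}" for l
    unfolding S[OF that] by (rule coordinate_matrix_carrier[OF A[OF that] B[OF that] Mc[OF that]])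
  show "Q1 \<in> carrier_mat (2 * m * t) d" "Q2 \<in> carrier_mat (2 * m * t) d"
    unfolding Q1 Q2 d' by (rule block_row_carrier, simp only: ls map_carrier_mat Sc)+
  have T_stack: "T *\<^sub>v stack_vecs (map f ?ls) = stack_vecs (map (\<lambda>l. M l *\<^sub>v f l) ?ls)"
    if "\<And>l. l \<in> {1..r} \<Longrightarrow> f l \<in> carrier_vec (?c l)" for f
    unfolding T using that by (intro diag_block_mat_mult_stack_vecs) auto
  have split: "\<exists>f. (\<forall>l\<in>{1..r}. f l \<in> carrier_vec (?c l)) \<and> y = stack_vecs (map f ?ls)"
    if "y \<in> carrier_vec d" for y
    using carrier_vec_stack_vecs[of ?ls y ?c] that ls unfolding d' by (metis distinct_upt)
  show T_inj: "inj_on ((*\<^sub>v) T) (carrier_vec d)"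
  proof (intro inj_onI)
    fix y z assume "y \<in> carrier_vec d" "z \<in> carrier_vec d" and eq: "T *\<^sub>v y = T *\<^sub>v z"
    then obtain f h where f: "\<And>l. l \<in> {1..r} \<Longrightarrow> f l \<in> carrier_vec (?c l)" and y: "y = stack_vecs (map f ?ls)"
      and h: "\<And>l. l \<in> {1..r} \<Longrightarrow> h l \<in> carrier_vec (?c l)" and z: "z = stack_vecs (map h ?ls)"
      using split by metis
    have "stack_vecs (map (\<lambda>l. M l *\<^sub>v f l) ?ls) = stack_vecs (map (\<lambda>l. M l *\<^sub>v h l) ?ls)"
      using eq T_stack[OF f] T_stack[OF h] unfolding y z by simp
    then have "\<forall>l\<in>set ?ls. M l *\<^sub>v f l = M l *\<^sub>v h l"
      by (subst (asm) stack_vecs_map_eq_iff) simp_all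
    then have "f l = h l" if "l \<in> {1..r}" for l
      using bij_betw_imp_inj_on[OF bij[OF that]] f[OF that] h[OF that] that ls by (auto dest: inj_onD)
    then show "y = z" unfolding y z using ls by (metis map_cong)
  qed
  have rep: "stacked_rep r X = stack_vecs (map (\<lambda>l. ?g (X l)) ?ls)" for X
    by (simp add: stacked_rep_def)
  have key: "X \<in> ?Sol \<longleftrightarrow> stack_vecs (map f ?ls) \<in> ?Y" "stacked_rep r X = T *\<^sub>v stack_vecs (map f ?ls)"
    if X: "X \<in> (\<Pi>\<^sub>E l\<in>{1..r}. L_struct (n l) (s l) (\<Omega> l))"
      and f: "\<And>l. l \<in> {1..r} \<Longrightarrow> f l \<in> carrier_vec (?c l)"
      and Xf: "\<And>l. l \<in> {1..r} \<Longrightarrow> ?g (X l) = M l *\<^sub>v f l" for X f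
  proof -
    have Xc: "X l \<in> carrier_mat (n l) (s l)" if "l \<in> {1..r}" for l
      using X that by (auto simp: L_struct_def PiE_def Pi_def)
    have "stack_vecs (map f ?ls) \<in> carrier_vec d"
      unfolding d' using f by (intro stack_vecs_carrier) auto
    then show "X \<in> ?Sol \<longleftrightarrow> stack_vecs (map f ?ls) \<in> ?Y"
      using X system_in_coordinates[OF A B E Xc Mc f Xf S] unfolding Q1 Q2 e L_solutions_def by simp
    show "stacked_rep r X = T *\<^sub>v stack_vecs (map f ?ls)"
    proof -
      have "T *\<^sub>v stack_vecs (map f ?ls) = stack_vecs (map (\<lambda>l. M l *\<^sub>v f l) ?ls)"
        by (rule T_stack) (rule f)
      moreover have "map (\<lambda>l. M l *\<^sub>v f l) ?ls = map (\<lambda>l. ?g (X l)) ?ls"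
        by (rule map_cong[OF refl]) (simp only: ls Xf)
      ultimately show ?thesis by (simp only: rep)
    qed
  qed
  have Sol_PiE: "?Sol \<subseteq> (\<Pi>\<^sub>E l\<in>{1..r}. L_struct (n l) (s l) (\<Omega> l))" by (auto simp: L_solutions_def)
  show "bij_betw (stacked_rep r) ?Sol ((*\<^sub>v) T ` ?Y)"
    unfolding bij_betw_def
  proof (intro conjI equalityI subsetI inj_onI)
    fix X X' assume X: "X \<in> ?Sol" "X' \<in> ?Sol" and eq: "stacked_rep r X = stacked_rep r X'"
    have Xc: "X l \<in> carrier_mat (n l) (s l)" "X' l \<in> carrier_mat (n l) (s l)" if "l \<in> {1..r}" for l
      using X Sol_PiE that by (auto simp: L_struct_def PiE_def Pi_def)
    have dims: "dim_vec (?g (X l)) = dim_vec (?g (X' l))" if "l \<in> set ?ls" for l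
      using Xc[of l] that by (simp add: ls vec_mat_real_rep del: upt_Suc)
    have "\<forall>l\<in>set ?ls. ?g (X l) = ?g (X' l)"
      using stack_vecs_map_eq_iff[of ?ls "\<lambda>l. ?g (X l)" "\<lambda>l. ?g (X' l)", OF dims] eq unfolding rep by blast
    then have "X l = X' l" if "l \<in> {1..r}" for l
      using real_rep_inj[OF Xc[OF that]] that ls by blast
    then show "X = X'" using X Sol_PiE by (meson PiE_ext subsetD)
  next
    fix v assume "v \<in> stacked_rep r ` ?Sol"
    then obtain X where X: "X \<in> ?Sol" "v = stacked_rep r X" by blast
    have "\<exists>y\<in>carrier_vec (?c l). ?g (X l) = M l *\<^sub>v y" if "l \<in> {1..r}" for l
    proof -
      have "X l \<in> L_struct (n l) (s l) (\<Omega> l)" using X Sol_PiE that by (auto simp: PiE_def Pi_def)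
      then show ?thesis using bij_betw_imp_surj_on[OF bij[OF that]] by blast
    qed
    then obtain f where "\<And>l. l \<in> {1..r} \<Longrightarrow> f l \<in> carrier_vec (?c l)" "\<And>l. l \<in> {1..r} \<Longrightarrow> ?g (X l) = M l *\<^sub>v f l"
      by metis
    from key[OF subsetD[OF Sol_PiE X(1)] this] X show "v \<in> (*\<^sub>v) T ` ?Y" by blast
  next
    fix v assume "v \<in> (*\<^sub>v) T ` ?Y"
    then obtain y where y: "y \<in> ?Y" "v = T *\<^sub>v y" by blast
    then obtain f where f: "\<And>l. l \<in> {1..r} \<Longrightarrow> f l \<in> carrier_vec (?c l)" and yf: "y = stack_vecs (map f ?ls)"
      using split by blast
    have "\<exists>X\<in>L_struct (n l) (s l) (\<Omega> l). ?g X = M l *\<^sub>v f l" if "l \<in> {1..r}" for l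
      using bij_betwE[OF bij[OF that]] f[OF that] by (metis imageE)
    then obtain X where X: "\<And>l. l \<in> {1..r} \<Longrightarrow> X l \<in> L_struct (n l) (s l) (\<Omega> l)"
      "\<And>l. l \<in> {1..r} \<Longrightarrow> ?g (X l) = M l *\<^sub>v f l" by metis
    \<comment> \<open>Solutions are extensional, so the chosen tuple has to be made undefined outside \<open>{1..r}\<close>.\<close>
    define X' where "X' = restrict X {1..r}"
    have X': "X' \<in> (\<Pi>\<^sub>E l\<in>{1..r}. L_struct (n l) (s l) (\<Omega> l))"
      using X(1) by (simp add: X'_def)
    have Xf: "?g (X' l) = M l *\<^sub>v f l" if "l \<in> {1..r}" for l using X(2)[OF that] that by (simp add: X'_def)
    have "X' \<in> ?Sol \<longleftrightarrow> y \<in> ?Y" unfolding yf by (rule key(1)[OF X'], erule f, erule Xf)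
    moreover have "stacked_rep r X' = T *\<^sub>v y" unfolding yf by (rule key(2)[OF X'], erule f, erule Xf)
    ultimately show "v \<in> stacked_rep r ` ?Sol" using y by (metis imageI)
  qed
qed

lemma ex1_in_iff_card: "(\<exists>!x. x \<in> A) \<longleftrightarrow> card A = 1"
  by (auto simp: card_1_singleton_iff)

text \<open>With \<open>V = [Q1; Q2]\<close>, what remains is the theory of the real system \<open>V y = e\<close>, transported
  by the injective map \<open>T\<close>: its solutions are \<open>V\<^sup>\<dagger> e + (I - V\<^sup>\<dagger> V) z\<close>, and Cline's formula
  gives the closed forms of \<open>V\<^sup>\<dagger>\<close> and of \<open>V\<^sup>\<dagger> V\<close>.\<close>
theorem theorem4p5:
  fixes r m t d :: nat
    and n s :: "nat \<Rightarrow> nat"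
    and A B :: "nat \<Rightarrow> rbq mat"
    and E :: "rbq mat"
    and \<Omega> :: "nat \<Rightarrow> rbq vec set"
    and M :: "nat \<Rightarrow> real mat"
    and S :: "nat \<Rightarrow> complex mat"
    and Q1 Q2 T R Z H :: "real mat"
    and e :: "real vec"
  assumes "r \<ge> 1"
    and "\<And>l. l \<in> {1..r} \<Longrightarrow> A l \<in> carrier_mat m (n l)"
    and "\<And>l. l \<in> {1..r} \<Longrightarrow> B l \<in> carrier_mat (s l) t"
    and "E \<in> carrier_mat m t"
    and "\<And>l. l \<in> {1..r} \<Longrightarrow> real_subspace (n l * s l) (\<Omega> l)"
    and "\<And>l. l \<in> {1..r} \<Longrightarrow> L_basis_matrix (n l) (s l) (\<Omega> l) (M l)"
    and "d = (\<Sum>l = 1..r. dim_col (M l))"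
    and "\<And>l. l \<in> {1..r} \<Longrightarrow>
           S l = ((hrep (B l))\<^sup>T \<otimes>\<^sub>K map_mat cpart1 (A l)
                  + (hrep (times_j (B l)))\<^sup>T \<otimes>\<^sub>K map_mat cpart2 (A l))
                 * Wmat (n l * s l) * map_mat complex_of_real (M l)"
    and "Q1 = block_row (2 * m * t) (map (\<lambda>l. map_mat Re (S l)) [1..<Suc r])"
    and "Q2 = block_row (2 * m * t) (map (\<lambda>l. map_mat Im (S l)) [1..<Suc r])"
    and "e = vec_mat (map_mat Re (Psi E)) @\<^sub>v vec_mat (map_mat Im (Psi E))"
    and "T = diag_block_mat (map M [1..<Suc r])"
    and "R = (1\<^sub>m d - Q1\<^sup>\<dagger> * Q1) * Q2\<^sup>T"
    and "Z = the (mat_inverse (1\<^sub>m (2 * m * t)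
               + (1\<^sub>m (2 * m * t) - R\<^sup>\<dagger> * R) * Q2 * Q1\<^sup>\<dagger> * (Q1\<^sup>\<dagger>)\<^sup>T * Q2\<^sup>T * (1\<^sub>m (2 * m * t) - R\<^sup>\<dagger> * R)))"
    and "H = R\<^sup>\<dagger> + (1\<^sub>m (2 * m * t) - R\<^sup>\<dagger> * R) * Z * Q2 * Q1\<^sup>\<dagger> * (Q1\<^sup>\<dagger>)\<^sup>T * (1\<^sub>m d - Q2\<^sup>T * R\<^sup>\<dagger>)"
  shows "(L_solutions r m t n s \<Omega> A B E \<noteq> {} \<longleftrightarrow>
            ((Q1 @\<^sub>r Q2) * (Q1 @\<^sub>r Q2)\<^sup>\<dagger>) *\<^sub>v e = e) \<and>
    (((Q1 @\<^sub>r Q2) * (Q1 @\<^sub>r Q2)\<^sup>\<dagger>) *\<^sub>v e = e \<longrightarrow>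
      stacked_rep r ` L_solutions r m t n s \<Omega> A B E =
        {(T * block_row d [Q1\<^sup>\<dagger> - H\<^sup>T * Q2 * Q1\<^sup>\<dagger>, H\<^sup>T]) *\<^sub>v e
           + (T * (1\<^sub>m d - Q1\<^sup>\<dagger> * Q1 - R * R\<^sup>\<dagger>)) *\<^sub>v y | y. y \<in> carrier_vec d}) \<and>
    (((Q1 @\<^sub>r Q2) * (Q1 @\<^sub>r Q2)\<^sup>\<dagger>) *\<^sub>v e = e \<longrightarrow>
      ((\<exists>!X. X \<in> L_solutions r m t n s \<Omega> A B E) \<longleftrightarrow>
         vec_space.rank (dim_row (Q1 @\<^sub>r Q2)) (Q1 @\<^sub>r Q2) = d) \<and>
      ((\<exists>!X. X \<in> L_solutions r m t n s \<Omega> A B E) \<longrightarrow>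
         (\<forall>X \<in> L_solutions r m t n s \<Omega> A B E.
            stacked_rep r X = (T * block_row d [Q1\<^sup>\<dagger> - H\<^sup>T * Q2 * Q1\<^sup>\<dagger>, H\<^sup>T]) *\<^sub>v e)))"
proof -
  let ?Sol = "L_solutions r m t n s \<Omega> A B E" and ?V = "Q1 @\<^sub>r Q2" and ?N = "2 * m * t + 2 * m * t"
  let ?Y = "{y \<in> carrier_vec d. ?V *\<^sub>v y = e}"
  let ?X = "block_row d [Q1\<^sup>\<dagger> - H\<^sup>T * Q2 * Q1\<^sup>\<dagger>, H\<^sup>T]" and ?K = "1\<^sub>m d - Q1\<^sup>\<dagger> * Q1 - R * R\<^sup>\<dagger>"
  note bij_facts = L_solutions_bij_betw[OF assms(2,3,4,5,6,8,7,9,10,11,12)]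
  have Q1: "Q1 \<in> carrier_mat (2 * m * t) d" and Q2: "Q2 \<in> carrier_mat (2 * m * t) d"
    and T_inj: "inj_on ((*\<^sub>v) T) (carrier_vec d)" and bij: "bij_betw (stacked_rep r) ?Sol ((*\<^sub>v) T ` ?Y)"
    by (rule bij_facts; assumption)+
  have V: "?V \<in> carrier_mat ?N d" by (rule carrier_append_rows[OF Q1 Q2])
  have e: "e \<in> carrier_vec ?N"
    using assms(4) by (intro carrier_vecI) (simp add: assms(11) Psi_eq algebra_simps)
  obtain N where T: "T \<in> carrier_mat N d"
  proof
    have "dim_col T = (\<Sum>l\<leftarrow>[1..<Suc r]. dim_col (M l))"
      unfolding assms(12) dim_diag_block_mat by (simp add: o_def)
    also have "\<dots> = d"
      unfolding assms(7) by (subst sum.distinct_set_conv_list[symmetric]) (auto intro!: sum.cong)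
    finally show "T \<in> carrier_mat (dim_row T) d" by (intro carrier_matI refl)
  qed
  have dR: "dim_row R = d" "dim_col R = 2 * m * t" using Q1 Q2 by (simp_all add: assms(13))
  have dH: "dim_col H = d" using dR by (simp add: assms(15))
  note cline = pinv_append_rows[OF Q1 Q2 assms(13,14,15)]
  have X: "?V\<^sup>\<dagger> = ?X" unfolding cline(1) using dH by simp
  have K: "1\<^sub>m d - ?V\<^sup>\<dagger> * ?V = ?K"
    unfolding cline(2) using Q1 dR by (intro eq_matI) (simp_all del: index_mult_mat(1))
  have Xc: "?X \<in> carrier_mat d ?N" unfolding X[symmetric] using Q1 Q2 by (intro carrier_matI) simp_all
  have Kc: "?K \<in> carrier_mat d d" using dR by (intro carrier_matI) simp_all
  have T_Y: "(*\<^sub>v) T ` ?Y = {(T * ?X) *\<^sub>v e + (T * ?K) *\<^sub>v y | y. y \<in> carrier_vec d}"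
    if c: "(?V * ?V\<^sup>\<dagger>) *\<^sub>v e = e"
  proof -
    have "?Y = {?X *\<^sub>v e + ?K *\<^sub>v z | z. z \<in> carrier_vec d}"
      using linear_system_solutions[OF V e c, unfolded K, unfolded X] .
    then have "(*\<^sub>v) T ` ?Y = (\<lambda>z. T *\<^sub>v (?X *\<^sub>v e + ?K *\<^sub>v z)) ` carrier_vec d"
      by (simp only: Setcompr_eq_image image_image)
    also have "\<dots> = (\<lambda>z. (T * ?X) *\<^sub>v e + (T * ?K) *\<^sub>v z) ` carrier_vec d"
    proof (rule image_cong[OF refl])
      fix z :: "real vec" assume z: "z \<in> carrier_vec d"
      show "T *\<^sub>v (?X *\<^sub>v e + ?K *\<^sub>v z) = (T * ?X) *\<^sub>v e + (T * ?K) *\<^sub>v z"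
        using mult_add_distrib_mat_vec[OF T mult_mat_vec_carrier[OF Xc e] mult_mat_vec_carrier[OF Kc z]]
        by (simp only: assoc_mult_mat_vec[OF T Xc e] assoc_mult_mat_vec[OF T Kc z])
    qed
    finally show ?thesis by (simp only: Setcompr_eq_image)
  qed
  have solvable: "?Sol \<noteq> {} \<longleftrightarrow> (?V * ?V\<^sup>\<dagger>) *\<^sub>v e = e"
    using linear_system_solvable_iff[OF V e] bij_betw_imp_surj_on[OF bij] by blast
  have unique: "(\<exists>!X. X \<in> ?Sol) \<longleftrightarrow> vec_space.rank (dim_row ?V) ?V = d"
    if c: "(?V * ?V\<^sup>\<dagger>) *\<^sub>v e = e"
  proof -
    obtain y0 where "y0 \<in> carrier_vec d" "?V *\<^sub>v y0 = e" using linear_system_solvable_iff[OF V e] c by blast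
    note rank = linear_system_unique_iff[OF V this]
    have "card ?Sol = card ?Y"
      using bij_betw_same_card[OF bij] card_image[OF inj_on_subset[OF T_inj], of ?Y] by auto
    then show ?thesis using rank carrier_matD(1)[OF V] by (simp only: ex1_in_iff_card)
  qed
  have unique_solution: "stacked_rep r X = (T * ?X) *\<^sub>v e"
    if c: "(?V * ?V\<^sup>\<dagger>) *\<^sub>v e = e" and ex1: "\<exists>!X. X \<in> ?Sol" and "X \<in> ?Sol" for X
  proof -
    \<comment> \<open>the member of the general solution for the parameter value \<open>0\<close>\<close>
    have "?X *\<^sub>v e \<in> ?Y"
      using c mult_mat_vec_carrier[OF Xc e] unfolding X by (simp only: assoc_mult_mat_vec[OF V Xc e] mem_Collect_eq simp_thms)
    then have "(T * ?X) *\<^sub>v e \<in> stacked_rep r ` ?Sol"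
      unfolding bij_betw_imp_surj_on[OF bij] assoc_mult_mat_vec[OF T Xc e] by (rule imageI)
    then obtain X' where X': "(T * ?X) *\<^sub>v e = stacked_rep r X'" "X' \<in> ?Sol" by (rule imageE)
    have "X' = X" using ex1 X'(2) \<open>X \<in> ?Sol\<close> by blast
    with X'(1) show ?thesis by (simp only:)
  qed
  show ?thesis
  proof (intro conjI impI ballI)
    show "?Sol \<noteq> {} \<longleftrightarrow> (?V * ?V\<^sup>\<dagger>) *\<^sub>v e = e" by (rule solvable)
  next
    assume c: "(?V * ?V\<^sup>\<dagger>) *\<^sub>v e = e"
    show "stacked_rep r ` ?Sol = {(T * ?X) *\<^sub>v e + (T * ?K) *\<^sub>v y | y. y \<in> carrier_vec d}"
      unfolding T_Y[OF c, symmetric] by (rule bij_betw_imp_surj_on[OF bij])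
    show "(\<exists>!X. X \<in> ?Sol) \<longleftrightarrow> vec_space.rank (dim_row ?V) ?V = d" by (rule unique[OF c])
    show "stacked_rep r X = (T * ?X) *\<^sub>v e" if "\<exists>!X. X \<in> ?Sol" "X \<in> ?Sol" for X
      by (rule unique_solution[OF c that])
  qed
qed

end
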